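(* Denote by $H(\mathbb{Z})$ the subgroup of $SL_3(\mathbb{Z})$ consisting of all upper-triangular matrices. Then $H(\mathbb{Z})$ is a maximal Haagerup subgroup of $SL_3(\mathbb{Z})$.
   Context: A (discrete countable) group $G$ has the Haagerup property if there is a sequence of positive-definite functions in $c_0(G)$ converging pointwise to $1$. A maximal Haagerup subgroup of $G$ is a subgroup of $G$ with the Haagerup property that is not properly contained in any other subgroup of $G$ with the Haagerup property. *)

theory Defs
  imports "HOL-Analysis.Analysis" "HOL-Algebra.Algebra"
begin

definition positive_definite :: "('a, 'b) monoid_scheme \<Rightarrow> ('a \<Rightarrow> complex) \<Rightarrow> bool" where
  "positive_definite G \<phi> \<longleftrightarrow>
     (\<forall>F c. finite F \<longrightarrow> F \<subseteq> carrier G \<longrightarrow>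
        (\<Sum>g\<in>F. \<Sum>h\<in>F. cnj (c g) * c h * \<phi> (inv\<^bsub>G\<^esub> g \<otimes>\<^bsub>G\<^esub> h)) \<in> \<real>\<^sub>\<ge>\<^sub>0)"

definition vanishing_at_infinity :: "('a, 'b) monoid_scheme \<Rightarrow> ('a \<Rightarrow> complex) \<Rightarrow> bool" where
  "vanishing_at_infinity G \<phi> \<longleftrightarrow>
     (\<forall>\<epsilon>>0. finite {g \<in> carrier G. cmod (\<phi> g) \<ge> \<epsilon>})"

(* Functions on G are represented by functions on the ambient type; only their values on
   the carrier matter.  Countability of the carrier is not required separately, because it
   follows: the carrier is covered by the finite sets where cmod (phi n g) is at least 1/2. *)
definition haagerup_property :: "('a, 'b) monoid_scheme \<Rightarrow> bool" where
  "haagerup_property G \<longleftrightarrow>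
     group G \<and>
     (\<exists>\<phi> :: nat \<Rightarrow> 'a \<Rightarrow> complex.
        (\<forall>n. positive_definite G (\<phi> n) \<and> vanishing_at_infinity G (\<phi> n)) \<and>
        (\<forall>g\<in>carrier G. (\<lambda>n. \<phi> n g) \<longlonglongrightarrow> 1))"

definition haagerup_subgroup :: "'a set \<Rightarrow> ('a, 'b) monoid_scheme \<Rightarrow> bool" where
  "haagerup_subgroup H G \<longleftrightarrow> subgroup H G \<and> haagerup_property (G\<lparr>carrier := H\<rparr>)"

definition maximal_haagerup_subgroup :: "'a set \<Rightarrow> ('a, 'b) monoid_scheme \<Rightarrow> bool" where
  "maximal_haagerup_subgroup H G \<longleftrightarrow>
     haagerup_subgroup H G \<and> (\<forall>K. haagerup_subgroup K G \<longrightarrow> \<not> H \<subset> K)"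

definition SL3Z :: "(int ^ 3 ^ 3) monoid" where
  "SL3Z = \<lparr>carrier = {A. det A = 1}, mult = (**), one = mat 1\<rparr>"

(* The diagonal entries are arbitrary (hence 1 or -1), so this is larger than the unipotent
   Heisenberg group.  The three entries are listed explicitly because the order on the index
   type 3 is 3 = 0 < 1 < 2, which is not the usual order of rows and columns. *)
definition HZ :: "(int ^ 3 ^ 3) set" where
  "HZ = {A \<in> carrier SL3Z. A $ 2 $ 1 = 0 \<and> A $ 3 $ 1 = 0 \<and> A $ 3 $ 2 = 0}"

end

(* HZ is amenable: the boxes with superdiagonal entries at most n and corner entry at most n^2 are
   Folner sets, and normalised overlaps of Folner sets are positive definite functions of finite
   support.  For maximality, a subgroup K above HZ contains an element moving the line <e1> or the
   plane <e1, e2>.  Conjugating transvections of HZ by it gives a copy t of Z^2 in K together with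
   two elements of K acting on it by opposite unipotent shears.  If K were Haagerup, some positive
   definite phi, tending to 0 at infinity, would be close to 1 on the finitely many elements involved.
   Then phi o t defines a positive functional on trigonometric polynomials on the torus that is
   almost invariant under the dual shears, lives mostly near (1, 1) and, by decay of phi, gives no
   mass to (1, 1) itself.  This is impossible, because the dual shears play ping-pong on the
   directions at (1, 1).  Working with the functional and the Stone-Weierstrass theorem avoids the
   representing measure of Bochner's theorem. *)
theory Submission
  imports Defs "HOL-Real_Asymp.Real_Asymp"
begin

section \<open>Positive functionals on trigonometric polynomials\<close>

text \<open>The invariance is only approximate, and the size \<open>m\<close> of the shears is
  dictated by the element outside \<open>HZ\<close>. So the closeness of \<phi> to 1 is chosen after
  \<open>m\<close>, and a Chebyshev type estimate turns it into concentration near (1, 1) at a cost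
  of order \<open>m ^ 4\<close>. For test functions with values in [0, 2], the functional is at most
  3/2 times its value on the sheared function, up to a small error. Ping-pong fits two disjoint
  sheared copies of one sector into the other. Since 2 exceeds 3/2, both sectors have almost no
  mass. Yet they cover everything except a small neighbourhood of (1, 1), which is charged to a
  kernel whose pairing with \<psi> is small.\<close>

definition positive_definite_Z2 :: "(int \<times> int \<Rightarrow> complex) \<Rightarrow> bool" where
  "positive_definite_Z2 \<psi> \<longleftrightarrow>
     (\<forall>F c. finite F \<longrightarrow> (\<Sum>u\<in>F. \<Sum>v\<in>F. cnj (c u) * c v * \<psi> (v - u)) \<in> \<real>\<^sub>\<ge>\<^sub>0)"

text \<open>Polynomials are formal, with repeated exponents allowed. Hence \<open>trig_pair\<close>
  needs no proof that the coefficients are determined by the function, and shears act directly on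
  exponents.\<close>

type_synonym trig_poly = "(complex \<times> int \<times> int) list"

definition trig_eval :: "trig_poly \<Rightarrow> complex \<Rightarrow> complex \<Rightarrow> complex" where
  "trig_eval p z w = (\<Sum>(c, x, y)\<leftarrow>p. c * z powi x * w powi y)"

definition trig_pair :: "(int \<times> int \<Rightarrow> complex) \<Rightarrow> trig_poly \<Rightarrow> complex" where
  "trig_pair \<psi> p = (\<Sum>(c, x, y)\<leftarrow>p. c * \<psi> (x, y))"

lemma trig_eval_simps [simp]:
  "trig_eval [] z w = 0"
  "trig_eval ((c, x, y) # p) z w = c * z powi x * w powi y + trig_eval p z w"
  "trig_eval (p @ q) z w = trig_eval p z w + trig_eval q z w"
  by (auto simp: trig_eval_def)

lemma trig_pair_simps [simp]:
  "trig_pair \<psi> [] = 0"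
  "trig_pair \<psi> ((c, x, y) # p) = c * \<psi> (x, y) + trig_pair \<psi> p"
  "trig_pair \<psi> (p @ q) = trig_pair \<psi> p + trig_pair \<psi> q"
  by (auto simp: trig_pair_def)

lemma sum_root_of_unity_powers:
  fixes k :: int
  assumes "M > 0" and "\<bar>k\<bar> < int M"
  shows "(\<Sum>s<M. cis (2 * pi * real s / real M) powi k) = (if k = 0 then of_nat M else 0)"
proof (cases "k = 0")
  case True
  then show ?thesis by simp
next
  case False
  define q where "q = cis (2 * pi * of_int k / real M)"
  have pow: "cis (2 * pi * real s / real M) powi k = q ^ s" for s
    by (simp add: q_def cis_power_int Complex.DeMoivre mult_ac)
  have "q \<noteq> 1"
  proof
    assume "q = 1"
    then have "cos (2 * pi * of_int k / real M) = 1"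
      by (simp add: q_def complex_eq_iff)
    then obtain n :: int where "2 * pi * of_int k / real M = of_int n * 2 * pi"
      by (auto simp: cos_one_2pi_int)
    then have "real_of_int k = of_int n * real M"
      using assms(1) by (simp add: field_simps)
    then have "real_of_int k = real_of_int (n * int M)"
      by simp
    then have "k = n * int M"
      by (simp only: of_int_eq_iff)
    with False assms(2) show False
      by (simp add: abs_mult)
  qed
  moreover have "q ^ M = 1"
  proof -
    have "q ^ M = cis (2 * pi * of_int k)"
      using assms(1) by (simp add: q_def Complex.DeMoivre)
    then show ?thesis
      by (simp add: cis_multiple_2pi)
  qed
  ultimately show ?thesis
    using False by (simp add: pow geometric_sum)
qed

definition square_box :: "nat \<Rightarrow> (int \<times> int) set" where
  "square_box N = {0..<int N} \<times> {0..<int N}"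

lemma finite_square_box [simp]: "finite (square_box N)"
  by (simp add: square_box_def)

lemma sum_trig_eval_times:
  "(\<Sum>s\<in>A. trig_eval p (z s) (w s) * S s) =
     (\<Sum>(c, x, y)\<leftarrow>p. c * (\<Sum>s\<in>A. z s powi x * w s powi y * S s))"
  by (induction p) (auto simp: sum.distrib algebra_simps sum_distrib_left)

lemma card_square_box_shift:
  "card {u \<in> square_box N. u + (x, y) \<in> square_box N} = nat (int N - \<bar>x\<bar>) * nat (int N - \<bar>y\<bar>)"
proof -
  have "{u \<in> square_box N. u + (x, y) \<in> square_box N} =
      {max 0 (- x)..<min (int N) (int N - x)} \<times> {max 0 (- y)..<min (int N) (int N - y)}"
    by (auto simp: square_box_def)
  moreover have "nat (min (int N) (int N - a) - max 0 (- a)) = nat (int N - \<bar>a\<bar>)" for a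
    by linarith
  ultimately show ?thesis
    by (simp add: card_cartesian_product)
qed

text \<open>The Schur product of the Toeplitz matrices of \<open>\<psi>\<close> and of the Fourier coefficients of a
  nonnegative \<open>p\<close> is positive; the second one is diagonalised by a sufficiently fine grid of roots of
  unity.\<close>

lemma Fejer_sum_nonneg:
  assumes \<psi>: "positive_definite_Z2 \<psi>"
    and p: "\<And>z w. cmod z = 1 \<Longrightarrow> cmod w = 1 \<Longrightarrow> Re (trig_eval p z w) \<ge> 0"
  shows "Re (\<Sum>(c, x, y)\<leftarrow>p. c * \<psi> (x, y) *
           of_nat (card {u \<in> square_box N. u + (x, y) \<in> square_box N})) \<ge> 0"
proof -
  define F where "F = square_box N"
  have [simp]: "finite F" by (simp add: F_def)
  obtain D where D: "\<And>c x y. (c, x, y) \<in> set p \<Longrightarrow> nat \<bar>x\<bar> \<le> D \<and> nat \<bar>y\<bar> \<le> D"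
  proof
    fix c x y assume "(c, x, y) \<in> set p"
    then show "nat \<bar>x\<bar> \<le> Max ((\<lambda>(c, x, y). nat (\<bar>x\<bar> + \<bar>y\<bar>)) ` set p) \<and>
               nat \<bar>y\<bar> \<le> Max ((\<lambda>(c, x, y). nat (\<bar>x\<bar> + \<bar>y\<bar>)) ` set p)"
      by (auto intro!: Max_ge_iff[THEN iffD2] rev_bexI)
  qed
  \<comment> \<open>The exponents below are a frequency of \<open>p\<close> minus a difference of
    two box points, hence at most \<open>D + N\<close> in absolute value. A grid of \<open>M\<close>
    points does not confuse such an exponent with 0.\<close>
  define M where "M = Suc (D + N)"
  define \<zeta> where "\<zeta> s = cis (2 * pi * real s / real M)" for s
  have \<zeta> [simp]: "cmod (\<zeta> s) = 1" "\<zeta> s \<noteq> 0" for s by (auto simp: \<zeta>_def)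
  have cnj_\<zeta>: "cnj (\<zeta> s) = inverse (\<zeta> s)" for s
    by (simp add: \<zeta>_def cis_cnj)
  \<comment> \<open>The quadratic form of \<psi> at a character of the grid restricted to the box,
    therefore nonnegative.\<close>
  define S where "S = (\<lambda>(s, t). \<Sum>u\<in>F. \<Sum>v\<in>F.
      cnj (\<zeta> s powi (- fst u) * \<zeta> t powi (- snd u)) * (\<zeta> s powi (- fst v) * \<zeta> t powi (- snd v)) * \<psi> (v - u))"
  have S: "S st \<in> \<real>\<^sub>\<ge>\<^sub>0" for st
  proof -
    obtain s t where st: "st = (s, t)" by fastforce
    show ?thesis
      using \<psi>[unfolded positive_definite_Z2_def, rule_format, of F
          "\<lambda>u. \<zeta> s powi (- fst u) * \<zeta> t powi (- snd u)"]
      by (simp only: st S_def prod.case \<open>finite F\<close> simp_thms)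
  qed
  define A where "A = {..<M} \<times> {..<M}"
  \<comment> \<open>Orthogonality of the grid characters retains exactly the pairs with
    \<open>v - u = (x, y)\<close>.\<close>
  have coeff: "(\<Sum>st\<in>A. \<zeta> (fst st) powi x * \<zeta> (snd st) powi y * S st) =
      of_nat (M * M) * (\<psi> (x, y) * of_nat (card {u \<in> F. u + (x, y) \<in> F}))"
    if xy: "(c, x, y) \<in> set p" for c x y
  proof -
    have "(\<Sum>st\<in>A. \<zeta> (fst st) powi x * \<zeta> (snd st) powi y * S st) =
        (\<Sum>st\<in>A. \<Sum>u\<in>F. \<Sum>v\<in>F. \<psi> (v - u) *
           (\<zeta> (fst st) powi (x - (fst v - fst u)) * \<zeta> (snd st) powi (y - (snd v - snd u))))"
      unfolding S_def
      by (simp add: split_beta sum_distrib_left cnj_\<zeta> power_int_diff power_int_add power_int_minus power_int_inverse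
            field_simps)
    also have "\<dots> = (\<Sum>u\<in>F. \<Sum>v\<in>F. \<psi> (v - u) *
        (\<Sum>st\<in>A. \<zeta> (fst st) powi (x - (fst v - fst u)) * \<zeta> (snd st) powi (y - (snd v - snd u))))"
      by (simp add: sum_distrib_left sum.swap[of _ F A])
    also have "\<dots> = (\<Sum>u\<in>F. \<Sum>v\<in>F. if v = u + (x, y) then of_nat (M * M) * \<psi> (x, y) else 0)"
    proof (intro sum.cong refl)
      fix u v assume uv: "u \<in> F" "v \<in> F"
      have "(\<Sum>st\<in>A. \<zeta> (fst st) powi (x - (fst v - fst u)) * \<zeta> (snd st) powi (y - (snd v - snd u))) =
          (\<Sum>s<M. \<zeta> s powi (x - (fst v - fst u))) * (\<Sum>s<M. \<zeta> s powi (y - (snd v - snd u)))"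
        by (simp add: A_def sum_product sum.cartesian_product split_beta)
      also have "\<dots> = (if v = u + (x, y) then of_nat (M * M) else 0)"
      proof -
        have "M > 0" by (simp add: M_def)
        moreover have "\<bar>x - (fst v - fst u)\<bar> < int M" "\<bar>y - (snd v - snd u)\<bar> < int M"
          using D[OF xy] uv by (auto simp: F_def square_box_def M_def)
        ultimately show ?thesis
          unfolding \<zeta>_def by (subst (1 2) sum_root_of_unity_powers) (auto simp: prod_eq_iff)
      qed
      finally show "\<psi> (v - u) * (\<Sum>st\<in>A. \<zeta> (fst st) powi (x - (fst v - fst u)) * \<zeta> (snd st) powi (y - (snd v - snd u))) =
          (if v = u + (x, y) then of_nat (M * M) * \<psi> (x, y) else 0)"
        by simp
    qed
    also have "\<dots> = (\<Sum>u\<in>F. if u + (x, y) \<in> F then of_nat (M * M) * \<psi> (x, y) else 0)"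
      by simp
    also have "\<dots> = of_nat (M * M) * (\<psi> (x, y) * of_nat (card {u \<in> F. u + (x, y) \<in> F}))"
      by (simp flip: sum.inter_filter)
    finally show ?thesis .
  qed
  have "(\<Sum>st\<in>A. trig_eval p (\<zeta> (fst st)) (\<zeta> (snd st)) * S st) =
      (\<Sum>(c, x, y)\<leftarrow>p. c * (of_nat (M * M) * (\<psi> (x, y) * of_nat (card {u \<in> F. u + (x, y) \<in> F}))))"
    unfolding sum_trig_eval_times
    by (intro arg_cong[where f = sum_list] map_cong refl) (auto simp: coeff split del: if_split)
  also have "\<dots> = of_nat (M * M) * (\<Sum>(c, x, y)\<leftarrow>p. c * \<psi> (x, y) * of_nat (card {u \<in> F. u + (x, y) \<in> F}))"
    by (induction p) (auto simp: algebra_simps)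
  finally have "of_nat (M * M) * (\<Sum>(c, x, y)\<leftarrow>p. c * \<psi> (x, y) * of_nat (card {u \<in> F. u + (x, y) \<in> F})) =
      (\<Sum>st\<in>A. trig_eval p (\<zeta> (fst st)) (\<zeta> (snd st)) * S st)" ..
  moreover have "Re (trig_eval p (\<zeta> (fst st)) (\<zeta> (snd st)) * S st) \<ge> 0" for st
    using S[of st] p[of "\<zeta> (fst st)" "\<zeta> (snd st)"] by (auto simp: complex_nonneg_Reals_iff)
  ultimately have "Re (of_nat (M * M) * (\<Sum>(c, x, y)\<leftarrow>p. c * \<psi> (x, y) * of_nat (card {u \<in> F. u + (x, y) \<in> F}))) \<ge> 0"
    by (simp only: Re_sum sum_nonneg)
  moreover have "Re (of_nat (M * M) * w) = real (M * M) * Re w" for w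
    by simp
  ultimately have "0 \<le> real (M * M) * Re (\<Sum>(c, x, y)\<leftarrow>p. c * \<psi> (x, y) * of_nat (card {u \<in> F. u + (x, y) \<in> F}))"
    by simp
  moreover have "real (M * M) > 0" by (simp add: M_def del: of_nat_mult of_nat_add)
  ultimately show ?thesis
    unfolding F_def by (simp add: zero_le_mult_iff)
qed

text \<open>Divided by \<open>N ^ 2\<close>, the preceding sum weights each coefficient by the
  proportion of the box that a fixed shift leaves inside the box. This tends to 1, and the
  inequality passes to the limit.\<close>

lemma trig_pair_nonneg:
  assumes \<psi>: "positive_definite_Z2 \<psi>"
    and p: "\<And>z w. cmod z = 1 \<Longrightarrow> cmod w = 1 \<Longrightarrow> Re (trig_eval p z w) \<ge> 0"
  shows "Re (trig_pair \<psi> p) \<ge> 0"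
proof -
  define r where "r N x y = real (card {u \<in> square_box N. u + (x, y) \<in> square_box N}) / real N ^ 2" for N x y
  have fac: "(\<lambda>N. real (nat (int N - \<bar>x\<bar>)) / real N) \<longlonglongrightarrow> 1" for x
  proof -
    have "(\<lambda>N. 1 - of_int \<bar>x\<bar> / real N) \<longlonglongrightarrow> 1 - 0"
      by (intro tendsto_intros lim_const_over_n)
    moreover have "\<forall>\<^sub>F N in sequentially. 1 - of_int \<bar>x\<bar> / real N = real (nat (int N - \<bar>x\<bar>)) / real N"
      using eventually_ge_at_top[of "nat \<bar>x\<bar> + 1"] by eventually_elim (simp add: field_simps of_nat_nat)
    ultimately show ?thesis
      by (simp add: tendsto_cong)
  qed
  have r: "(\<lambda>N. r N x y) \<longlonglongrightarrow> 1" for x y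
    using tendsto_mult[OF fac[of x] fac[of y]]
    by (simp add: r_def card_square_box_shift power2_eq_square)
  have "(\<lambda>N. \<Sum>(c, x, y)\<leftarrow>p. c * \<psi> (x, y) * of_real (r N x y)) \<longlonglongrightarrow> trig_pair \<psi> p"
  proof (induction p)
    case (Cons a p)
    obtain c x y where a: "a = (c, x, y)" by (cases a)
    have "(\<lambda>N. c * \<psi> (x, y) * of_real (r N x y)) \<longlonglongrightarrow> c * \<psi> (x, y) * of_real 1"
      by (intro tendsto_intros r)
    from tendsto_add[OF this Cons] show ?case by (simp add: a)
  qed simp
  then have "(\<lambda>N. Re (\<Sum>(c, x, y)\<leftarrow>p. c * \<psi> (x, y) * of_real (r N x y))) \<longlonglongrightarrow> Re (trig_pair \<psi> p)"
    by (rule tendsto_Re)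
  moreover have "Re (\<Sum>(c, x, y)\<leftarrow>p. c * \<psi> (x, y) * of_real (r N x y)) \<ge> 0" for N
  proof -
    have "(\<Sum>(c, x, y)\<leftarrow>p. c * \<psi> (x, y) * of_real (r N x y)) =
        of_real (1 / real N ^ 2) * (\<Sum>(c, x, y)\<leftarrow>p. c * \<psi> (x, y) *
          of_nat (card {u \<in> square_box N. u + (x, y) \<in> square_box N}))"
      by (induction p) (auto simp: r_def algebra_simps)
    moreover have "Re (of_real (1 / real N ^ 2) * v) \<ge> 0" if "Re v \<ge> 0" for v
      using that by simp
    ultimately show ?thesis
      using Fejer_sum_nonneg[OF \<psi> p] by presburger
  qed
  ultimately show ?thesis
    by (intro LIMSEQ_le_const) auto
qed

section \<open>Products, conjugates and density of trigonometric polynomials on the torus\<close>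

definition trig_mult :: "trig_poly \<Rightarrow> trig_poly \<Rightarrow> trig_poly" where
  "trig_mult p q = concat (map (\<lambda>(c, x, y). map (\<lambda>(d, x', y'). (c * d, x + x', y + y')) q) p)"

definition trig_cnj :: "trig_poly \<Rightarrow> trig_poly" where
  "trig_cnj p = map (\<lambda>(c, x, y). (cnj c, - x, - y)) p"

definition trig_scale :: "complex \<Rightarrow> trig_poly \<Rightarrow> trig_poly" where
  "trig_scale a p = map (\<lambda>(c, x, y). (a * c, x, y)) p"

lemma trig_eval_scale [simp]: "trig_eval (trig_scale a p) z w = a * trig_eval p z w"
  by (induction p) (auto simp: trig_scale_def algebra_simps)

lemma trig_pair_scale [simp]: "trig_pair \<psi> (trig_scale a p) = a * trig_pair \<psi> p"
  by (induction p) (auto simp: trig_scale_def algebra_simps)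

lemma trig_eval_cnj:
  assumes "cmod z = 1" "cmod w = 1"
  shows "trig_eval (trig_cnj p) z w = cnj (trig_eval p z w)"
proof -
  have "cnj u powi x = u powi (- x)" if "cmod u = 1" for u x
  proof -
    have "cnj u = inverse u"
      using that by (metis complex_cnj_cnj complex_mod_cnj inverse_complex_def divide_complex_def
          complex_norm_square inverse_unique mult.commute of_real_1 one_power2)
    then show ?thesis
      by (simp add: power_int_minus power_int_inverse)
  qed
  with assms show ?thesis
    by (induction p) (auto simp: trig_cnj_def)
qed

lemma trig_eval_mult:
  assumes "z \<noteq> 0" "w \<noteq> 0"
  shows "trig_eval (trig_mult p q) z w = trig_eval p z w * trig_eval q z w"
proof -
  have "trig_eval (map (\<lambda>(d, x', y'). (c * d, x + x', y + y')) q) z w =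
      c * z powi x * w powi y * trig_eval q z w" for c x y
    using assms by (induction q) (auto simp: power_int_add algebra_simps)
  then show ?thesis
    by (induction p) (auto simp: trig_mult_def algebra_simps)
qed

definition torus :: "(complex \<times> complex) set" where
  "torus = sphere 0 1 \<times> sphere 0 1"

lemma mem_torus [simp]: "(z, w) \<in> torus \<longleftrightarrow> cmod z = 1 \<and> cmod w = 1"
  by (simp add: torus_def)

lemma continuous_on_trig_eval: "continuous_on torus (\<lambda>zw. trig_eval p (fst zw) (snd zw))"
proof (induction p)
  case (Cons a p)
  obtain c x y where a: "a = (c, x, y)" by (cases a)
  have "continuous_on torus (\<lambda>zw. c * fst zw powi x * snd zw powi y)"
  proof -
    have "\<forall>zw\<in>torus. fst zw \<noteq> 0 \<and> snd zw \<noteq> 0"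
      by (auto simp: torus_def)
    then show ?thesis
      by (intro continuous_on_mult continuous_on_const continuous_on_power_int
          continuous_on_fst continuous_on_snd continuous_on_id) auto
  qed
  from continuous_on_add[OF this Cons] show ?case by (simp add: a)
qed simp

lemma trig_poly_dense:
  fixes f :: "complex \<times> complex \<Rightarrow> real"
  assumes f: "continuous_on torus f" and e: "e > 0"
  obtains p where "\<And>z w. (z, w) \<in> torus \<Longrightarrow> \<bar>f (z, w) - Re (trig_eval p z w)\<bar> < e"
proof -
  define P where "P g \<longleftrightarrow> (\<exists>p. \<forall>z w. (z, w) \<in> torus \<longrightarrow> g (z, w) = Re (trig_eval p z w))"
    for g :: "complex \<times> complex \<Rightarrow> real"
  have "compact torus"
    by (simp add: torus_def compact_Times)
  moreover have "P (\<lambda>_. c)" for c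
    unfolding P_def by (rule exI[of _ "[(of_real c, 0, 0)]"]) auto
  moreover have "continuous_on torus g" if "P g" for g
  proof -
    from that obtain p where p: "\<forall>z w. (z, w) \<in> torus \<longrightarrow> g (z, w) = Re (trig_eval p z w)"
      by (auto simp: P_def)
    have "continuous_on torus (\<lambda>zw. Re (trig_eval p (fst zw) (snd zw)))"
      by (intro continuous_intros continuous_on_trig_eval)
    then show ?thesis
      by (rule continuous_on_eq) (use p in auto)
  qed
  moreover have "P (\<lambda>x. g x + h x)" if "P g \<and> P h" for g h
  proof -
    from that obtain p q where "\<forall>z w. (z, w) \<in> torus \<longrightarrow> g (z, w) = Re (trig_eval p z w)"
        "\<forall>z w. (z, w) \<in> torus \<longrightarrow> h (z, w) = Re (trig_eval q z w)"
      by (auto simp: P_def)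
    then show ?thesis
      unfolding P_def by (intro exI[of _ "p @ q"]) auto
  qed
  moreover have "P (\<lambda>x. g x * h x)" if "P g \<and> P h" for g h
  proof -
    from that obtain p q where pq: "\<forall>z w. (z, w) \<in> torus \<longrightarrow> g (z, w) = Re (trig_eval p z w)"
        "\<forall>z w. (z, w) \<in> torus \<longrightarrow> h (z, w) = Re (trig_eval q z w)"
      by (auto simp: P_def)
    \<comment> \<open>Real parts are closed under products because
      \<open>Re a * Re b = Re (a * (b + cnj b)) / 2\<close>.\<close>
    have "Re (trig_eval (trig_scale (1/2) (trig_mult p (q @ trig_cnj q))) z w) =
        Re (trig_eval p z w) * Re (trig_eval q z w)" if "cmod z = 1" "cmod w = 1" for z w
    proof -
      have "z \<noteq> 0" "w \<noteq> 0" using that by auto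
      then show ?thesis
        using that by (simp add: trig_eval_mult trig_eval_cnj complex_add_cnj algebra_simps)
    qed
    then show ?thesis
      using pq unfolding P_def by (intro exI[of _ "trig_scale (1/2) (trig_mult p (q @ trig_cnj q))"]) auto
  qed
  moreover have "\<exists>g. P g \<and> g u \<noteq> g v" if "u \<in> torus \<and> v \<in> torus \<and> u \<noteq> v" for u v
  proof -
    have sep: "P (\<lambda>(z, w). Re z)" "P (\<lambda>(z, w). Im z)" "P (\<lambda>(z, w). Re w)" "P (\<lambda>(z, w). Im w)"
      unfolding P_def
      by (rule exI[of _ "[(1, 1, 0)]"], force, rule exI[of _ "[(- \<i>, 1, 0)]"], force,
          rule exI[of _ "[(1, 0, 1)]"], force, rule exI[of _ "[(- \<i>, 0, 1)]"], force)
    obtain z w z' w' where uv: "u = (z, w)" "v = (z', w')"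
      by fastforce
    with that have "Re z \<noteq> Re z' \<or> Im z \<noteq> Im z' \<or> Re w \<noteq> Re w' \<or> Im w \<noteq> Im w'"
      by (auto simp: complex_eq_iff)
    then show ?thesis
      by (elim disjE) (rule exI, rule conjI, rule sep, simp add: uv)+
  qed
  ultimately obtain g where "P g" "\<forall>x\<in>torus. \<bar>f x - g x\<bar> < e"
    using Stone_Weierstrass_HOL[of torus P f e] f e by blast
  then show thesis
    using that unfolding P_def by (metis abs_minus_commute)
qed

section \<open>Ping-pong on the torus\<close>

lemma trig_pair_mono:
  assumes "positive_definite_Z2 \<psi>"
    and "\<And>z w. (z, w) \<in> torus \<Longrightarrow> Re (trig_eval p z w) \<le> Re (trig_eval q z w)"
  shows "Re (trig_pair \<psi> p) \<le> Re (trig_pair \<psi> q)"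
  using trig_pair_nonneg[OF assms(1), of "q @ trig_scale (-1) p"] assms(2) by simp

text \<open>The name refers to the torus: adding \<open>k * y\<close> to the first exponent is dual
  to multiplying the second coordinate \<open>w\<close> by \<open>z powi k\<close>.\<close>

definition shear_snd :: "int \<Rightarrow> trig_poly \<Rightarrow> trig_poly" where
  "shear_snd k p = map (\<lambda>(c, x, y). (c, x + k * y, y)) p"

definition shear_fst :: "int \<Rightarrow> trig_poly \<Rightarrow> trig_poly" where
  "shear_fst k p = map (\<lambda>(c, x, y). (c, x, y + k * x)) p"

lemma trig_eval_shear_snd:
  "z \<noteq> 0 \<Longrightarrow> trig_eval (shear_snd k p) z w = trig_eval p z (w * z powi k)"
  by (induction p) (auto simp: shear_snd_def power_int_add power_int_mult power_int_mult_distrib)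

lemma trig_eval_shear_fst:
  "w \<noteq> 0 \<Longrightarrow> trig_eval (shear_fst k p) z w = trig_eval p (z * w powi k) w"
  by (induction p) (auto simp: shear_fst_def power_int_add power_int_mult power_int_mult_distrib)

lemma trig_pair_shear_snd: "trig_pair \<psi> (shear_snd k p) = trig_pair (\<lambda>(x, y). \<psi> (x + k * y, y)) p"
  by (induction p) (auto simp: shear_snd_def)

lemma trig_pair_shear_fst: "trig_pair \<psi> (shear_fst k p) = trig_pair (\<lambda>(x, y). \<psi> (x, y + k * x)) p"
  by (induction p) (auto simp: shear_fst_def)

text \<open>The quotient of \<open>1 - z ^ k\<close> by \<open>1 - z\<close> is the sum of the
  \<open>z ^ i\<close> for \<open>i < k\<close>. Each term is within \<open>k * cmod (1 - z)\<close>
  of 1, so the sum is within 1 of \<open>k\<close> and has modulus at least 4.\<close>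

lemma chord_power_ge:
  fixes z :: complex
  assumes "cmod z = 1" and "k \<ge> 5" and "cmod (1 - z) * real k ^ 2 \<le> 1"
  shows "4 * cmod (1 - z) \<le> cmod (1 - z ^ k)"
proof -
  have "cmod (of_nat k - (\<Sum>i<k. z ^ i)) = cmod (\<Sum>i<k. 1 - z ^ i)"
    by (simp add: sum_subtractf)
  also have "\<dots> \<le> (\<Sum>i<k. real k * cmod (1 - z))"
  proof (intro sum_norm_le)
    fix i assume "i \<in> {..<k}"
    have "cmod (1 ^ i - z ^ i) \<le> real i * cmod (1 - z)"
      using assms(1) by (intro norm_power_diff) auto
    also have "\<dots> \<le> real k * cmod (1 - z)"
      using \<open>i \<in> {..<k}\<close> by (intro mult_right_mono) auto
    finally show "cmod (1 - z ^ i) \<le> real k * cmod (1 - z)" by simp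
  qed
  also have "\<dots> \<le> 1"
    using assms(3) by (simp add: power2_eq_square mult_ac)
  finally have "cmod (of_nat k - (\<Sum>i<k. z ^ i)) \<le> 1" .
  moreover have "cmod (of_nat k) \<le> cmod (of_nat k - (\<Sum>i<k. z ^ i)) + cmod (\<Sum>i<k. z ^ i)"
    by (metis norm_triangle_sub add.commute)
  ultimately have "4 \<le> cmod (\<Sum>i<k. z ^ i)"
    using assms(2) by simp
  then show ?thesis
    using mult_left_mono[of 4 "cmod (\<Sum>i<k. z ^ i)" "cmod (1 - z)"]
    by (simp add: one_diff_power_eq norm_mult)
qed

text \<open>A function of the direction at \<open>(1, 1)\<close>; only the truncation of the denominator at \<open>\<delta>\<close>
  makes it continuous there.\<close>

definition sector :: "real \<Rightarrow> complex \<Rightarrow> complex \<Rightarrow> real" where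
  "sector \<delta> z w = max 0 (min 1 ((2 * cmod (1 - z) - cmod (1 - w)) / max (cmod (1 - z) + cmod (1 - w)) \<delta>))"

lemma sector_bounds: "0 \<le> sector \<delta> z w" "sector \<delta> z w \<le> 1"
  by (auto simp: sector_def)

lemma sector_pos_imp:
  assumes "\<delta> > 0" "sector \<delta> z w > 0"
  shows "cmod (1 - w) < 2 * cmod (1 - z)"
  using assms by (auto simp: sector_def zero_less_divide_iff max_def not_le split: if_splits) 

lemma sector_eq_1:
  assumes "\<delta> > 0" "cmod (1 - z) + cmod (1 - w) \<ge> \<delta>" "2 * cmod (1 - w) \<le> cmod (1 - z)"
  shows "sector \<delta> z w = 1"
  using assms by (simp add: sector_def max_absorb1 min_absorb1 pos_le_divide_eq)

text \<open>The numerators \<open>2 * a - b\<close> and \<open>2 * b - a\<close> add up to the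
  denominator \<open>a + b\<close>, so the two quotients are some \<open>s\<close> and
  \<open>1 - s\<close>, and clamping to [0, 1] preserves the sum.\<close>

lemma sector_swap_sum:
  assumes "\<delta> > 0" "cmod (1 - z) + cmod (1 - w) \<ge> \<delta>"
  shows "sector \<delta> z w + sector \<delta> w z = 1"
proof -
  have "max 0 (min 1 s) + max 0 (min 1 (1 - s)) = 1" for s :: real
    by auto
  moreover have "(2 * cmod (1 - w) - cmod (1 - z)) / (cmod (1 - w) + cmod (1 - z)) =
      1 - (2 * cmod (1 - z) - cmod (1 - w)) / (cmod (1 - z) + cmod (1 - w))"
    using assms by (simp add: field_simps)
  moreover have "max (cmod (1 - w) + cmod (1 - z)) \<delta> = cmod (1 - w) + cmod (1 - z)"
      "max (cmod (1 - z) + cmod (1 - w)) \<delta> = cmod (1 - z) + cmod (1 - w)"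
    using assms by auto
  ultimately show ?thesis
    unfolding sector_def by presburger
qed

lemma continuous_on_sector:
  assumes "\<delta> > 0"
  shows "continuous_on A (\<lambda>zw. sector \<delta> (fst zw) (snd zw))"
    and "continuous_on A (\<lambda>zw. sector \<delta> (snd zw) (fst zw))"
  using assms unfolding sector_def by (auto intro!: continuous_intros)

text \<open>The two sheared sectors are disjoint and lie where the complementary sector function equals
  \<open>1\<close>: this is the ping-pong step.\<close>

lemma sector_shear:
  assumes z: "cmod z = 1" and w: "cmod w = 1" and m: "m \<ge> 5" and \<delta>: "\<delta> > 0"
    and near: "cmod (1 - z) * real (2 * m) ^ 2 \<le> 1"
  shows "sector \<delta> z (w * z powi int m) + sector \<delta> z (w * z powi (- int m)) \<le>
     sector \<delta> w z + (if cmod (1 - z) + cmod (1 - w) < \<delta> then 1 else 0)"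
proof -
  have z0: "z \<noteq> 0" using z by auto
  \<comment> \<open>The two sheared points differ by the factor \<open>z ^ (2 * m)\<close>, which is
    why nearness is measured with \<open>2 * m\<close>; it implies the same for
    \<open>m\<close>.\<close>
  have m2: "4 * cmod (1 - z) \<le> cmod (1 - z ^ (2 * m))"
    using z m near by (intro chord_power_ge) auto
  have "cmod (1 - z) * real m ^ 2 \<le> cmod (1 - z) * real (2 * m) ^ 2"
    by (intro mult_left_mono power_mono) auto
  with near have m1: "4 * cmod (1 - z) \<le> cmod (1 - z ^ m)"
    using z m by (intro chord_power_ge) auto
  define u where "u = z ^ m"
  have u: "cmod u = 1" "u \<noteq> 0" using z z0 by (auto simp: u_def norm_power)
  have zp: "w * z powi int m = w * u" "w * z powi (- int m) = w / u"
    by (auto simp: u_def power_int_minus divide_inverse)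
  have u1: "4 * cmod (1 - z) \<le> cmod (1 - u)" and u2: "4 * cmod (1 - z) \<le> cmod (1 - u * u)"
    using m1 m2 by (auto simp: u_def power_add[symmetric] mult_2)
  have e1: "cmod (1 - w / u) = cmod (u - w)"
    using u by (metis diff_divide_distrib div_self norm_divide div_by_1)
  \<comment> \<open>A sheared point in the sector of \<open>z\<close> has second chord below
    \<open>2 * cmod (1 - z)\<close>. Against the expansion factor 4 = 2 + 2, the inequality
    \<open>c\<close> excludes that both points lie there, and \<open>a\<close> and \<open>b\<close>
    force \<open>cmod (1 - w)\<close> to be at least \<open>2 * cmod (1 - z)\<close> if one
    does.\<close>
  have a: "cmod (1 - u) \<le> cmod (1 - w) + cmod (1 - w * u)"
  proof -
    have "cmod (1 - u) \<le> cmod (1 - w * u) + cmod ((w - 1) * u)"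
      using norm_triangle_ineq[of "1 - w * u" "(w - 1) * u"] by (simp add: algebra_simps)
    then show ?thesis using u by (simp add: norm_mult norm_minus_commute)
  qed
  have b: "cmod (1 - u) \<le> cmod (1 - w) + cmod (1 - w / u)"
    using norm_triangle_ineq[of "1 - w" "w - u"] e1 by (simp add: norm_minus_commute)
  have c: "cmod (1 - u * u) \<le> cmod (1 - w * u) + cmod (1 - w / u)"
  proof -
    have "cmod (1 - u * u) \<le> cmod (1 - w * u) + cmod ((w - u) * u)"
      using norm_triangle_ineq[of "1 - w * u" "(w - u) * u"] by (simp add: algebra_simps)
    then show ?thesis using u e1 by (simp add: norm_mult norm_minus_commute)
  qed
  have one: "sector \<delta> w z = 1"
    if "2 * cmod (1 - z) \<le> cmod (1 - w)" "\<not> cmod (1 - z) + cmod (1 - w) < \<delta>"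
    using that \<delta> by (intro sector_eq_1) auto
  have "\<not> (sector \<delta> z (w * u) > 0 \<and> sector \<delta> z (w / u) > 0)"
    using sector_pos_imp[OF \<delta>, of z "w * u"] sector_pos_imp[OF \<delta>, of z "w / u"] c u2 by linarith
  moreover have "2 * cmod (1 - z) \<le> cmod (1 - w)"
    if "sector \<delta> z (w * u) > 0 \<or> sector \<delta> z (w / u) > 0"
    using that sector_pos_imp[OF \<delta>, of z "w * u"] sector_pos_imp[OF \<delta>, of z "w / u"] a b u1 by linarith
  ultimately show ?thesis
    unfolding zp using one sector_bounds[of \<delta> z "w * u"] sector_bounds[of \<delta> z "w / u"] sector_bounds[of \<delta> w z]
    by (cases "cmod (1 - z) + cmod (1 - w) < \<delta>") (simp, linarith)+
qed

text \<open>Here \<kappa> is the value of a kernel that is at least 1/4 near (1, 1), so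
  \<open>4 * \<kappa>\<close> dominates the indicator of the exceptional disc. If \<open>z\<close>
  is too far from 1 for the local estimate, then \<open>16 * m ^ 4 * (cmod (1 - z))^2\<close> is at
  least 1, and twice that dominates the left side, which is at most 2.\<close>

lemma sector_shear_global:
  assumes z: "cmod z = 1" and w: "cmod w = 1" and m: "m \<ge> 5" and \<delta>: "\<delta> > 0"
    and \<kappa>: "\<kappa> \<ge> 0" "cmod (1 - z) + cmod (1 - w) < \<delta> \<Longrightarrow> \<kappa> \<ge> 1 / 4"
  shows "sector \<delta> z (w * z powi int m) + sector \<delta> z (w * z powi (- int m)) \<le>
     sector \<delta> w z + 4 * \<kappa> + 32 * real m ^ 4 * (2 - 2 * Re z)"
proof -
  have sq: "(cmod (1 - z))\<^sup>2 = 2 - 2 * Re z"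
  proof -
    have "(cmod (1 - z))\<^sup>2 = (1 - Re z)\<^sup>2 + (Im z)\<^sup>2"
      by (simp add: cmod_power2)
    also have "\<dots> = 1 - 2 * Re z + ((Re z)\<^sup>2 + (Im z)\<^sup>2)"
      by (simp add: power2_eq_square algebra_simps)
    finally have "(cmod (1 - z))\<^sup>2 = 1 - 2 * Re z + ((Re z)\<^sup>2 + (Im z)\<^sup>2)" .
    then show ?thesis using z by (simp flip: cmod_power2)
  qed
  have nn: "0 \<le> 32 * real m ^ 4 * (2 - 2 * Re z)"
    using zero_le_power2[of "cmod (1 - z)"] unfolding sq by (intro mult_nonneg_nonneg) auto
  show ?thesis
  proof (cases "cmod (1 - z) * real (2 * m) ^ 2 \<le> 1")
    case True
    from sector_shear[OF z w m \<delta> True] show ?thesis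
      using \<kappa> nn by (auto split: if_splits)
  next
    case False
    then have "1 \<le> (cmod (1 - z) * real (2 * m) ^ 2)\<^sup>2"
      by (simp add: one_le_power)
    also have "\<dots> = 16 * real m ^ 4 * (2 - 2 * Re z)"
      by (simp add: power_mult_distrib sq)
    finally show ?thesis
      using \<kappa> sector_bounds[of \<delta> z "w * z powi int m"] sector_bounds[of \<delta> z "w * z powi (- int m)"]
        sector_bounds[of \<delta> w z] by linarith
  qed
qed

lemma trig_eval_near_1:
  assumes "Re (trig_eval p 1 1) = 1"
  obtains \<delta> where "\<delta> > 0"
    "\<And>z w. (z, w) \<in> torus \<Longrightarrow> cmod (1 - z) + cmod (1 - w) < \<delta> \<Longrightarrow> Re (trig_eval p z w) \<ge> 1 / 4"
proof -
  define f where "f = (\<lambda>zw. Re (trig_eval p (fst zw) (snd zw)))"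
  have "continuous_on torus f"
    unfolding f_def by (intro continuous_on_Re continuous_on_trig_eval)
  then have "\<exists>\<delta>>0. \<forall>x'\<in>torus. dist x' (1, 1) < \<delta> \<longrightarrow> dist (f x') (f (1, 1)) < 3 / 4"
    by (rule continuous_on_iff[THEN iffD1, rule_format]) auto
  then obtain \<delta> where "\<delta> > 0" and \<delta>: "\<forall>x'\<in>torus. dist x' (1, 1) < \<delta> \<longrightarrow> dist (f x') (f (1, 1)) < 3 / 4"
    by auto
  show thesis
  proof
    fix z w assume zw: "(z, w) \<in> torus" "cmod (1 - z) + cmod (1 - w) < \<delta>"
    have "dist (z, w) (1, 1) \<le> dist z 1 + dist w 1"
      by (simp add: dist_Pair_Pair sqrt_sum_squares_le_sum)
    with zw(2) have "dist (z, w) (1, 1) < \<delta>"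
      by (simp add: dist_norm norm_minus_commute)
    with \<delta> zw(1) have "dist (f (z, w)) (f (1, 1)) < 3 / 4"
      by blast
    then have "dist (Re (trig_eval p z w)) 1 < 3 / 4"
      using assms by (simp add: f_def)
    then show "Re (trig_eval p z w) \<ge> 1 / 4"
      unfolding dist_real_def by linarith
  qed fact
qed

text \<open>Invariance under the shears up to \<open>\<epsilon>\<close> is incompatible with \<open>\<psi>\<close> having most of its mass near
  \<open>(1, 1)\<close> but little at \<open>(1, 1)\<close> itself, the latter being measured by \<open>k\<close>.\<close>

lemma shear_invariance_bound:
  fixes L :: "trig_poly \<Rightarrow> real"
  assumes \<psi>: "positive_definite_Z2 \<psi>" and m: "m \<ge> 5"
  defines "L \<equiv> \<lambda>p. Re (trig_pair \<psi> p)"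
  assumes shear_snd: "\<And>p k. (\<And>z w. (z, w) \<in> torus \<Longrightarrow> Re (trig_eval p z w) \<in> {0..2}) \<Longrightarrow> \<bar>k\<bar> = int m \<Longrightarrow>
      2 * L p \<le> 3 * L (shear_snd k p) + 12 * \<epsilon>"
    and shear_fst: "\<And>p k. (\<And>z w. (z, w) \<in> torus \<Longrightarrow> Re (trig_eval p z w) \<in> {0..2}) \<Longrightarrow> \<bar>k\<bar> = int m \<Longrightarrow>
      2 * L p \<le> 3 * L (shear_fst k p) + 12 * \<epsilon>"
    and k: "\<And>z w. (z, w) \<in> torus \<Longrightarrow> Re (trig_eval k z w) \<ge> 0" "Re (trig_eval k 1 1) = 1"
  shows "Re (\<psi> (0, 0)) / 2 \<le>
    96 * real m ^ 4 * Re (4 * \<psi> (0, 0) - 2 * \<psi> (1, 0) - 2 * \<psi> (0, 1)) + 28 * L k + 48 * \<epsilon>"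
proof -
  \<comment> \<open>The kernel is given first; the truncation of the sectors is then adapted to it,
    so that \<open>k\<close> pays for the disc where they no longer add up to 1.\<close>
  obtain \<delta> where \<delta>: "\<delta> > 0"
    "\<And>z w. (z, w) \<in> torus \<Longrightarrow> cmod (1 - z) + cmod (1 - w) < \<delta> \<Longrightarrow> Re (trig_eval k z w) \<ge> 1 / 4"
    using trig_eval_near_1[OF k(2)] by blast
  \<comment> \<open>The approximation errors add up to \<open>24 * \<eta>\<close> times the total
    mass, that is one half of it; hence the factor 1/2 in the conclusion.\<close>
  define \<eta> :: real where "\<eta> = 1 / 48"
  obtain p0 where p0: "\<And>z w. (z, w) \<in> torus \<Longrightarrow> \<bar>sector \<delta> z w - Re (trig_eval p0 z w)\<bar> < \<eta>"
    using trig_poly_dense[OF continuous_on_sector(1)[OF \<delta>(1)], of \<eta>] by (auto simp: \<eta>_def)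
  obtain q0 where q0: "\<And>z w. (z, w) \<in> torus \<Longrightarrow> \<bar>sector \<delta> w z - Re (trig_eval q0 z w)\<bar> < \<eta>"
    using trig_poly_dense[OF continuous_on_sector(2)[OF \<delta>(1)], of \<eta>] by (auto simp: \<eta>_def)
  \<comment> \<open>Raised by \<eta>, the approximants lie above the sector functions, so they are
    nonnegative and can be used on both sides of the estimates.\<close>
  define p where "p = (of_real \<eta>, 0, 0) # p0"
  define q where "q = (of_real \<eta>, 0, 0) # q0"
  have p: "sector \<delta> z w \<le> Re (trig_eval p z w)" "Re (trig_eval p z w) \<le> sector \<delta> z w + 2 * \<eta>"
    if "(z, w) \<in> torus" for z w
    using p0[OF that] by (auto simp: p_def)
  have q: "sector \<delta> w z \<le> Re (trig_eval q z w)" "Re (trig_eval q z w) \<le> sector \<delta> w z + 2 * \<eta>"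
    if "(z, w) \<in> torus" for z w
    using q0[OF that] by (auto simp: q_def)
  have p02: "Re (trig_eval p z w) \<in> {0..2}" if "(z, w) \<in> torus" for z w
    using p[OF that] sector_bounds[of \<delta> z w] by (simp add: \<eta>_def)
  have q02: "Re (trig_eval q z w) \<in> {0..2}" if "(z, w) \<in> torus" for z w
    using q[OF that] sector_bounds[of \<delta> w z] by (simp add: \<eta>_def)
  have torus_shear: "(z, w * z powi i) \<in> torus" "(z * w powi i, w) \<in> torus" if "(z, w) \<in> torus" for z w i
    using that by (auto simp: norm_mult norm_power_int)
  define R where "R = 32 * real m ^ 4"
  have P: "L (shear_snd (int m) p) + L (shear_snd (- int m) p) \<le>
      L q + 4 * L k + R * Re (2 * \<psi> (0, 0) - 2 * \<psi> (1, 0)) + 4 * \<eta> * Re (\<psi> (0, 0))"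
  proof -
    have "L (shear_snd (int m) p @ shear_snd (- int m) p) \<le>
        L (q @ trig_scale 4 k @ trig_scale (of_real R) [(2, 0, 0), (- 2, 1, 0)] @ [(of_real (4 * \<eta>), 0, 0)])"
      unfolding L_def
    proof (rule trig_pair_mono[OF \<psi>])
      fix z w assume zw: "(z, w) \<in> torus"
      then have "z \<noteq> 0" by auto
      have "Re (trig_eval (shear_snd (int m) p @ shear_snd (- int m) p) z w) =
          Re (trig_eval p z (w * z powi int m)) + Re (trig_eval p z (w * z powi (- int m)))"
        using \<open>z \<noteq> 0\<close> by (simp add: trig_eval_shear_snd)
      also have "\<dots> \<le> sector \<delta> z (w * z powi int m) + sector \<delta> z (w * z powi (- int m)) + 4 * \<eta>"
        using p(2)[OF torus_shear(1)[OF zw, of "int m"]] p(2)[OF torus_shear(1)[OF zw, of "- int m"]] by linarith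
      also have "\<dots> \<le> sector \<delta> w z + 4 * Re (trig_eval k z w) + R * (2 - 2 * Re z) + 4 * \<eta>"
        unfolding R_def using sector_shear_global[of z w m \<delta> "Re (trig_eval k z w)"] m \<delta> k(1) zw by simp
      also have "\<dots> \<le> Re (trig_eval q z w) + 4 * Re (trig_eval k z w) + R * (2 - 2 * Re z) + 4 * \<eta>"
        using q(1)[OF zw] by simp
      also have "\<dots> = Re (trig_eval (q @ trig_scale 4 k @ trig_scale (of_real R) [(2, 0, 0), (- 2, 1, 0)] @ [(of_real (4 * \<eta>), 0, 0)]) z w)"
        by (simp add: algebra_simps)
      finally show "Re (trig_eval (shear_snd (int m) p @ shear_snd (- int m) p) z w) \<le> \<dots>" .
    qed
    then show ?thesis by (simp add: L_def algebra_simps)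
  qed
  have Q: "L (shear_fst (int m) q) + L (shear_fst (- int m) q) \<le>
      L p + 4 * L k + R * Re (2 * \<psi> (0, 0) - 2 * \<psi> (0, 1)) + 4 * \<eta> * Re (\<psi> (0, 0))"
  proof -
    have "L (shear_fst (int m) q @ shear_fst (- int m) q) \<le>
        L (p @ trig_scale 4 k @ trig_scale (of_real R) [(2, 0, 0), (- 2, 0, 1)] @ [(of_real (4 * \<eta>), 0, 0)])"
      unfolding L_def
    proof (rule trig_pair_mono[OF \<psi>])
      fix z w assume zw: "(z, w) \<in> torus"
      then have "w \<noteq> 0" by auto
      have "Re (trig_eval (shear_fst (int m) q @ shear_fst (- int m) q) z w) =
          Re (trig_eval q (z * w powi int m) w) + Re (trig_eval q (z * w powi (- int m)) w)"
        using \<open>w \<noteq> 0\<close> by (simp add: trig_eval_shear_fst)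
      also have "\<dots> \<le> sector \<delta> w (z * w powi int m) + sector \<delta> w (z * w powi (- int m)) + 4 * \<eta>"
        using q(2)[OF torus_shear(2)[OF zw, of "int m"]] q(2)[OF torus_shear(2)[OF zw, of "- int m"]] by linarith
      also have "\<dots> \<le> sector \<delta> z w + 4 * Re (trig_eval k z w) + R * (2 - 2 * Re w) + 4 * \<eta>"
        unfolding R_def using sector_shear_global[of w z m \<delta> "Re (trig_eval k z w)"] m \<delta> k(1) zw
        by (simp add: add.commute)
      also have "\<dots> \<le> Re (trig_eval p z w) + 4 * Re (trig_eval k z w) + R * (2 - 2 * Re w) + 4 * \<eta>"
        using p(1)[OF zw] by simp
      also have "\<dots> = Re (trig_eval (p @ trig_scale 4 k @ trig_scale (of_real R) [(2, 0, 0), (- 2, 0, 1)] @ [(of_real (4 * \<eta>), 0, 0)]) z w)"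
        by (simp add: algebra_simps)
      finally show "Re (trig_eval (shear_fst (int m) q @ shear_fst (- int m) q) z w) \<le> \<dots>" .
    qed
    then show ?thesis by (simp add: L_def algebra_simps)
  qed
  have "L [(1, 0, 0)] \<le> L (p @ q @ trig_scale 4 k)"
    unfolding L_def
  proof (rule trig_pair_mono[OF \<psi>])
    fix z w assume zw: "(z, w) \<in> torus"
    have "1 \<le> sector \<delta> z w + sector \<delta> w z + 4 * Re (trig_eval k z w)"
      using sector_swap_sum[OF \<delta>(1), of z w] \<delta>(2)[OF zw] k(1)[OF zw]
        sector_bounds[of \<delta> z w] sector_bounds[of \<delta> w z]
      by (cases "cmod (1 - z) + cmod (1 - w) < \<delta>") auto
    then show "Re (trig_eval [(1, 0, 0)] z w) \<le> Re (trig_eval (p @ q @ trig_scale 4 k) z w)"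
      using p(1)[OF zw] q(1)[OF zw] by simp
  qed
  then have total: "Re (\<psi> (0, 0)) \<le> L p + L q + 4 * L k"
    by (simp add: L_def)
  \<comment> \<open>Adding the two shears bounds \<open>4 * L p\<close> by \<open>3 * L q\<close>
    plus errors, and symmetrically. So \<open>4 * (L p + L q)\<close> is at most
    \<open>3 * (L p + L q)\<close> plus errors, and the sum itself is bounded by errors.\<close>
  have "2 * L p \<le> 3 * L (shear_snd (int m) p) + 12 * \<epsilon>" "2 * L p \<le> 3 * L (shear_snd (- int m) p) + 12 * \<epsilon>"
    by (rule shear_snd[OF p02]; simp)+
  moreover have "2 * L q \<le> 3 * L (shear_fst (int m) q) + 12 * \<epsilon>" "2 * L q \<le> 3 * L (shear_fst (- int m) q) + 12 * \<epsilon>"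
    by (rule shear_fst[OF q02]; simp)+
  ultimately have "L p + L q \<le> 3 * (R * Re (2 * \<psi> (0, 0) - 2 * \<psi> (1, 0)) + R * Re (2 * \<psi> (0, 0) - 2 * \<psi> (0, 1)))
      + 24 * L k + 24 * \<eta> * Re (\<psi> (0, 0)) + 48 * \<epsilon>"
    using P Q by (simp add: algebra_simps)
  also have "R * Re (2 * \<psi> (0, 0) - 2 * \<psi> (1, 0)) + R * Re (2 * \<psi> (0, 0) - 2 * \<psi> (0, 1)) =
      R * Re (4 * \<psi> (0, 0) - 2 * \<psi> (1, 0) - 2 * \<psi> (0, 1))"
    by (simp add: algebra_simps)
  finally show ?thesis
    using total by (simp add: R_def \<eta>_def)
qed

section \<open>Groups containing sheared copies of \<open>\<int>\<^sup>2\<close>\<close>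

lemma trig_pair_linear:
  "trig_pair (\<lambda>u. a * f u + b * g u + c * h u) p =
     a * trig_pair f p + b * trig_pair g p + c * trig_pair h p"
  by (induction p) (auto simp: algebra_simps)

lemma trig_pair_concat: "trig_pair \<psi> (concat ps) = (\<Sum>p\<leftarrow>ps. trig_pair \<psi> p)"
  by (induction ps) auto

text \<open>Positive definiteness is stated for sets of group elements, whereas a family such as
  \<open>t u\<close>, \<open>t u \<otimes> g\<close> may repeat some. Coefficients of equal elements
  are collected in \<open>c\<close>.\<close>

lemma positive_definite_family:
  fixes G (structure)
  assumes \<phi>: "positive_definite G \<phi>" and I: "finite I" and e: "e ` I \<subseteq> carrier G"
  shows "(\<Sum>i\<in>I. \<Sum>j\<in>I. cnj (d i) * d j * \<phi> (inv (e i) \<otimes> e j)) \<in> \<real>\<^sub>\<ge>\<^sub>0"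
proof -
  define c where "c g = (\<Sum>i\<in>{i \<in> I. e i = g}. d i)" for g
  have group_sum: "(\<Sum>j\<in>I. d j * f (e j)) = (\<Sum>h\<in>e ` I. c h * f h)" for f :: "_ \<Rightarrow> complex"
    unfolding sum.image_gen[OF I, of "\<lambda>j. d j * f (e j)" e]
    by (intro sum.cong refl) (simp add: c_def sum_distrib_right)
  have group_sum_cnj: "(\<Sum>j\<in>I. cnj (d j) * f (e j)) = (\<Sum>h\<in>e ` I. cnj (c h) * f h)" for f :: "_ \<Rightarrow> complex"
    unfolding sum.image_gen[OF I, of "\<lambda>j. cnj (d j) * f (e j)" e]
    by (intro sum.cong refl) (simp add: c_def sum_distrib_right)
  have "(\<Sum>i\<in>I. \<Sum>j\<in>I. cnj (d i) * d j * \<phi> (inv (e i) \<otimes> e j)) =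
      (\<Sum>i\<in>I. cnj (d i) * (\<Sum>j\<in>I. d j * \<phi> (inv (e i) \<otimes> e j)))"
    by (simp add: sum_distrib_left mult_ac)
  also have "\<dots> = (\<Sum>g\<in>e ` I. cnj (c g) * (\<Sum>h\<in>e ` I. c h * \<phi> (inv g \<otimes> h)))"
    unfolding group_sum[of "\<lambda>h. \<phi> (inv _ \<otimes> h)"] by (rule group_sum_cnj)
  also have "\<dots> = (\<Sum>g\<in>e ` I. \<Sum>h\<in>e ` I. cnj (c g) * c h * \<phi> (inv g \<otimes> h))"
    by (simp add: sum_distrib_left mult_ac)
  also have "\<dots> \<in> \<real>\<^sub>\<ge>\<^sub>0"
    using \<phi> I e unfolding positive_definite_def by blast
  finally show ?thesis .
qed

text \<open>The matrix coefficient of the vector \<open>a\<delta>\<^sub>1 + b\<delta>\<^sub>g\<close> of the GNS representation of \<open>\<phi>\<close>.\<close>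

lemma positive_definite_Z2_coefficient:
  fixes G (structure) and t :: "int \<times> int \<Rightarrow> _" and a b :: real
  assumes "group G" and \<phi>: "positive_definite G \<phi>"
    and t: "\<And>u. t u \<in> carrier G" "\<And>u v. t (u + v) = t u \<otimes> t v" and g: "g \<in> carrier G"
  shows "positive_definite_Z2 (\<lambda>u. of_real (a * a) * \<phi> (t u) + of_real (b * b) * \<phi> (inv g \<otimes> t u \<otimes> g)
           + of_real (a * b) * (\<phi> (t u \<otimes> g) + \<phi> (inv g \<otimes> t u)))"
  unfolding positive_definite_Z2_def
proof (intro allI impI)
  interpret group G by fact
  fix F :: "(int \<times> int) set" and c :: "int \<times> int \<Rightarrow> complex"
  assume F: "finite F"
  have inv_t: "inv (t u) \<otimes> (t v \<otimes> h) = t (v - u) \<otimes> h" if "h \<in> carrier G" for u v h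
  proof -
    have "t v = t u \<otimes> t (v - u)"
      by (simp flip: t(2))
    then show ?thesis
      using t(1) that by (simp add: m_assoc[symmetric])
  qed
  \<comment> \<open>The Boolean selects one of the two basis vectors, at \<one> or at
    \<open>g\<close>, that \<open>t u\<close> translates.\<close>
  define e where "e = (\<lambda>(u, i). t u \<otimes> (if i then g else \<one>))"
  define d where "d = (\<lambda>(u, i). c u * of_real (if i then b else a))"
  have sum_pairs: "(\<Sum>i\<in>F \<times> UNIV. f i) = (\<Sum>u\<in>F. \<Sum>i\<in>UNIV. f (u, i))" for f :: "_ \<times> bool \<Rightarrow> complex"
    by (simp add: sum.cartesian_product)
  have "(\<Sum>i\<in>F \<times> UNIV. \<Sum>j\<in>F \<times> UNIV. cnj (d i) * d j * \<phi> (inv (e i) \<otimes> e j)) \<in> \<real>\<^sub>\<ge>\<^sub>0"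
    using F t(1) g by (intro positive_definite_family[OF \<phi>]) (auto simp: e_def)
  also have "(\<Sum>i\<in>F \<times> UNIV. \<Sum>j\<in>F \<times> UNIV. cnj (d i) * d j * \<phi> (inv (e i) \<otimes> e j)) =
      (\<Sum>u\<in>F. \<Sum>i\<in>UNIV. \<Sum>v\<in>F. \<Sum>j\<in>UNIV. cnj (d (u, i)) * d (v, j) * \<phi> (inv (e (u, i)) \<otimes> e (v, j)))"
    by (simp only: sum_pairs)
  also have "\<dots> = (\<Sum>u\<in>F. \<Sum>v\<in>F. cnj (c u) * c v *
      (of_real (a * a) * \<phi> (t (v - u)) + of_real (b * b) * \<phi> (inv g \<otimes> t (v - u) \<otimes> g)
           + of_real (a * b) * (\<phi> (t (v - u) \<otimes> g) + \<phi> (inv g \<otimes> t (v - u)))))"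
    using g t(1) inv_t[of \<one>] inv_t[of g]
    by (simp add: UNIV_bool d_def e_def inv_mult_group m_assoc algebra_simps flip: sum.distrib)
  finally show "(\<Sum>u\<in>F. \<Sum>v\<in>F. cnj (c u) * c v *
      (of_real (a * a) * \<phi> (t (v - u)) + of_real (b * b) * \<phi> (inv g \<otimes> t (v - u) \<otimes> g)
           + of_real (a * b) * (\<phi> (t (v - u) \<otimes> g) + \<phi> (inv g \<otimes> t (v - u))))) \<in> \<real>\<^sub>\<ge>\<^sub>0" .
qed

text \<open>With \<open>\<xi> = \<delta>\<^sub>1\<close> and \<open>\<eta> = \<delta>\<^sub>g\<close> this is
  \<open>2\<parallel>\<xi>\<parallel>\<^sup>2 + \<parallel>2\<xi> - 3\<eta>\<parallel>\<^sup>2 = 3\<parallel>\<eta>\<parallel>\<^sup>2 + 6\<parallel>\<xi> - \<eta>\<parallel>\<^sup>2\<close> for the seminorm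
  attached to \<open>p\<close>.\<close>

lemma trig_pair_conjugate_le:
  fixes G (structure) and t :: "int \<times> int \<Rightarrow> _"
  assumes G: "group G" and \<phi>: "positive_definite G \<phi>"
    and t: "\<And>u. t u \<in> carrier G" "\<And>u v. t (u + v) = t u \<otimes> t v" and g: "g \<in> carrier G"
    and p: "\<And>z w. (z, w) \<in> torus \<Longrightarrow> Re (trig_eval p z w) \<in> {0..2}"
  shows "2 * Re (trig_pair (\<lambda>u. \<phi> (t u)) p) \<le>
     3 * Re (trig_pair (\<lambda>u. \<phi> (inv g \<otimes> t u \<otimes> g)) p) + 12 * Re (2 * \<phi> \<one> - \<phi> g - \<phi> (inv g))"
proof -
  interpret group G by fact
  define A where "A = trig_pair (\<lambda>u. \<phi> (t u)) p"
  define B where "B = trig_pair (\<lambda>u. \<phi> (inv g \<otimes> t u \<otimes> g)) p"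
  define C where "C = trig_pair (\<lambda>u. \<phi> (t u \<otimes> g) + \<phi> (inv g \<otimes> t u)) p"
  note pd = positive_definite_Z2_coefficient[OF G \<phi> t g]
  \<comment> \<open>Nonnegativity of the square of \<open>2\<xi> - 3\<eta>\<close>, from
    \<open>p \<ge> 0\<close>.\<close>
  have "0 \<le> Re (trig_pair (\<lambda>u. of_real (2 * 2) * \<phi> (t u) + of_real (- 3 * - 3) * \<phi> (inv g \<otimes> t u \<otimes> g)
           + of_real (2 * - 3) * (\<phi> (t u \<otimes> g) + \<phi> (inv g \<otimes> t u))) p)"
    using p by (intro trig_pair_nonneg[OF pd[of 2 "- 3"]]) auto
  then have 1: "0 \<le> 4 * Re A + 9 * Re B - 6 * Re C"
    unfolding trig_pair_linear A_def[symmetric] B_def[symmetric] C_def[symmetric] by simp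
  have t0: "t 0 = \<one>"
    using t(2)[of 0 0] t(1)[of 0] by simp
  \<comment> \<open>The bound \<open>p \<le> 2\<close> replaces the square of \<xi> - \<eta> by
    twice its value for the constant polynomial 1. Taken 6 times, this is the 12 of the
    conclusion.\<close>
  have "Re (trig_pair (\<lambda>u. of_real (1 * 1) * \<phi> (t u) + of_real (- 1 * - 1) * \<phi> (inv g \<otimes> t u \<otimes> g)
           + of_real (1 * - 1) * (\<phi> (t u \<otimes> g) + \<phi> (inv g \<otimes> t u))) p) \<le>
      Re (trig_pair (\<lambda>u. of_real (1 * 1) * \<phi> (t u) + of_real (- 1 * - 1) * \<phi> (inv g \<otimes> t u \<otimes> g)
           + of_real (1 * - 1) * (\<phi> (t u \<otimes> g) + \<phi> (inv g \<otimes> t u))) [(2, 0, 0)])"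
    using p by (intro trig_pair_mono[OF pd[of 1 "- 1"]]) auto
  then have 2: "Re A + Re B - Re C \<le> 2 * Re (2 * \<phi> \<one> - \<phi> g - \<phi> (inv g))"
    unfolding trig_pair_linear A_def[symmetric] B_def[symmetric] C_def[symmetric]
    using t0 g by (simp add: zero_prod_def)
  show ?thesis
    using 1 2 by (simp add: A_def B_def)
qed

text \<open>A Fejer kernel in the powers \<open>z\<^sup>q\<^sup>j\<close>, with \<open>q\<close> so large that all off-diagonal terms are at
  most \<open>\<epsilon>\<close>.\<close>

lemma concentrated_kernel:
  assumes fin: "\<And>\<epsilon>. \<epsilon> > 0 \<Longrightarrow> finite {j :: int. cmod (\<psi> (j, 0)) \<ge> \<epsilon>}" and N: "N > 0" and \<epsilon>: "\<epsilon> > 0"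
  obtains k where "\<And>z w. (z, w) \<in> torus \<Longrightarrow> Re (trig_eval k z w) \<ge> 0" "Re (trig_eval k 1 1) = 1"
    "Re (trig_pair \<psi> k) \<le> cmod (\<psi> (0, 0)) / real N + \<epsilon>"
proof -
  obtain q :: int where q: "q > 0" "\<And>j. \<bar>j\<bar> \<ge> q \<Longrightarrow> cmod (\<psi> (j, 0)) < \<epsilon>"
  proof
    define D where "D = insert 0 (abs ` {j :: int. cmod (\<psi> (j, 0)) \<ge> \<epsilon>})"
    have D: "finite D" using fin[OF \<epsilon>] by (simp add: D_def)
    show "Max D + 1 > 0" using Max_ge[OF D, of 0] by (simp add: D_def)
    show "cmod (\<psi> (j, 0)) < \<epsilon>" if "\<bar>j\<bar> \<ge> Max D + 1" for j
    proof (rule ccontr)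
      assume "\<not> cmod (\<psi> (j, 0)) < \<epsilon>"
      then have "\<bar>j\<bar> \<in> D" by (auto simp: D_def)
      from Max_ge[OF D this] that show False by simp
    qed
  qed
  \<comment> \<open>The kernel is the squared modulus of an average of \<open>N\<close> powers of
    \<open>z\<close>. Its \<open>N\<close> diagonal terms have weight \<open>1 / N ^ 2\<close> each,
    which leaves \<open>cmod (\<psi> (0, 0)) / N\<close>.\<close>
  define p :: trig_poly where "p = map (\<lambda>j. (1 / of_nat N, q * int j, 0)) [0..<N]"
  define k where "k = trig_mult p (trig_cnj p)"
  have eval_k: "trig_eval k z w = of_real ((cmod (trig_eval p z w))\<^sup>2)" if "(z, w) \<in> torus" for z w
  proof -
    have "z \<noteq> 0" "w \<noteq> 0" using that by auto
    then show ?thesis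
      using that by (simp add: k_def trig_eval_mult trig_eval_cnj complex_norm_square del: of_real_power)
  qed
  have "trig_eval p 1 1 = 1"
    using N by (simp add: trig_eval_def p_def o_def sum_list_triv)
  then have "Re (trig_eval k 1 1) = 1"
    by (simp add: eval_k)
  moreover have "Re (trig_eval k z w) \<ge> 0" if "(z, w) \<in> torus" for z w
    using eval_k[OF that] by simp
  moreover have "Re (trig_pair \<psi> k) \<le> cmod (\<psi> (0, 0)) / real N + \<epsilon>"
  proof -
    have "trig_pair \<psi> k = (\<Sum>i<N. \<Sum>j<N. \<psi> (q * (int i - int j), 0) / of_nat (N * N))"
      unfolding k_def p_def trig_mult_def trig_pair_concat
      by (simp add: trig_pair_def trig_cnj_def o_def
          interv_sum_list_conv_sum_set_nat atLeast0LessThan algebra_simps)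
    then have "Re (trig_pair \<psi> k) \<le> cmod (\<Sum>i<N. \<Sum>j<N. \<psi> (q * (int i - int j), 0) / of_nat (N * N))"
      by (metis complex_Re_le_cmod)
    also have "\<dots> \<le> (\<Sum>i<N. \<Sum>j<N. (if j = i then cmod (\<psi> (0, 0)) / real (N * N) else 0) + \<epsilon> / real (N * N))"
    proof (intro sum_norm_le)
      fix i j
      show "cmod (\<psi> (q * (int i - int j), 0) / of_nat (N * N)) \<le>
          (if j = i then cmod (\<psi> (0, 0)) / real (N * N) else 0) + \<epsilon> / real (N * N)"
      proof (cases "j = i")
        case False
        then have "1 * q \<le> \<bar>int i - int j\<bar> * q"
          using q(1) by (intro mult_right_mono) auto
        then have "q \<le> \<bar>q * (int i - int j)\<bar>"
          using q(1) by (simp add: abs_mult mult.commute)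
        from q(2)[OF this] False show ?thesis
          by (simp add: norm_divide norm_mult divide_right_mono)
      qed (use \<epsilon> in \<open>simp add: norm_divide norm_mult\<close>)
    qed
    also have "\<dots> = cmod (\<psi> (0, 0)) / real N + \<epsilon>"
      using N by (simp add: sum.distrib) (simp add: field_simps)
    finally show ?thesis .
  qed
  ultimately show thesis using that by blast
qed

theorem not_haagerup_if_shears:
  fixes G :: "('a, 'b) monoid_scheme" (structure) and t :: "int \<times> int \<Rightarrow> 'a" and m :: nat
  assumes H: "haagerup_property G"
    and t: "\<And>u. t u \<in> carrier G" "\<And>u v. t (u + v) = t u \<otimes> t v" and inj: "inj t"
    and a: "a \<in> carrier G" "\<And>x y. a \<otimes> t (x, y) = t (x + int m * y, y) \<otimes> a"
    and b: "b \<in> carrier G" "\<And>x y. b \<otimes> t (x, y) = t (x, y + int m * x) \<otimes> b"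
    and m: "m \<ge> 5"
  shows False
proof -
  from H have G: "group G" by (simp add: haagerup_property_def)
  interpret group G by fact
  obtain \<Phi> :: "nat \<Rightarrow> 'a \<Rightarrow> complex" where \<Phi>: "\<And>n. positive_definite G (\<Phi> n)"
    "\<And>n. vanishing_at_infinity G (\<Phi> n)" "\<And>g. g \<in> carrier G \<Longrightarrow> (\<lambda>n. \<Phi> n g) \<longlonglongrightarrow> 1"
    using H by (auto simp: haagerup_property_def)
  \<comment> \<open>With this choice the three error terms of the final bound are about 0.077, 0.056
    and at most 0.02, against a left side of nearly 1/2.\<close>
  define \<tau> where "\<tau> = 1 / (10000 * real m ^ 4)"
  have m4: "real m ^ 4 \<ge> 1" using m by simp
  have \<tau>: "\<tau> > 0" "\<tau> \<le> 1 / 10000" and m\<tau>: "real m ^ 4 * \<tau> = 1 / 10000"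
    using m m4 by (auto simp: \<tau>_def field_simps)
  define D where "D = {\<one>, t (1, 0), t (0, 1), a, inv a, b, inv b}"
  have "D \<subseteq> carrier G" using t(1) a b by (auto simp: D_def)
  have "\<forall>\<^sub>F n in sequentially. \<forall>g\<in>D. dist (\<Phi> n g) 1 < \<tau>"
  proof (rule eventually_ball_finite)
    show "finite D" by (simp add: D_def)
    show "\<forall>g\<in>D. \<forall>\<^sub>F n in sequentially. dist (\<Phi> n g) 1 < \<tau>"
    proof
      fix g assume "g \<in> D"
      with \<open>D \<subseteq> carrier G\<close> show "\<forall>\<^sub>F n in sequentially. dist (\<Phi> n g) 1 < \<tau>"
        by (intro tendstoD \<Phi>(3) \<tau>(1)) auto
    qed
  qed
  then obtain n where n: "\<forall>g\<in>D. dist (\<Phi> n g) 1 < \<tau>"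
    by (auto simp: eventually_sequentially)
  define \<phi> where "\<phi> = \<Phi> n"
  note \<phi> = \<Phi>(1)[of n, folded \<phi>_def]
  have near1: "\<bar>Re (\<phi> g) - 1\<bar> \<le> \<tau>" "cmod (\<phi> g) \<le> 1 + \<tau>" if "g \<in> D" for g
  proof -
    have "cmod (\<phi> g - 1) < \<tau>"
      using n that by (simp add: \<phi>_def dist_norm)
    then show "\<bar>Re (\<phi> g) - 1\<bar> \<le> \<tau>" "cmod (\<phi> g) \<le> 1 + \<tau>"
      using abs_Re_le_cmod[of "\<phi> g - 1"] norm_triangle_sub[of "\<phi> g" 1] by simp_all
  qed
  define \<psi> where "\<psi> u = \<phi> (t u)" for u
  have t0: "t (0, 0) = \<one>"
    using t(2)[of "(0, 0)" "(0, 0)"] t(1)[of "(0, 0)"] by simp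
  have \<psi>: "positive_definite_Z2 \<psi>"
    using positive_definite_Z2_coefficient[OF G \<phi> t one_closed, of 1 0] by (simp add: \<psi>_def[abs_def])
  have "finite {j. cmod (\<psi> (j, 0)) \<ge> \<epsilon>}" if "\<epsilon> > 0" for \<epsilon>
  proof (rule finite_imageD)
    have "finite {g \<in> carrier G. cmod (\<phi> g) \<ge> \<epsilon>}"
      using \<Phi>(2)[of n] that by (simp add: vanishing_at_infinity_def \<phi>_def)
    then show "finite ((\<lambda>j. t (j, 0)) ` {j. cmod (\<psi> (j, 0)) \<ge> \<epsilon>})"
      by (rule finite_subset[rotated]) (use t(1) in \<open>auto simp: \<psi>_def\<close>)
    show "inj_on (\<lambda>j. t (j, 0)) {j. cmod (\<psi> (j, 0)) \<ge> \<epsilon>}"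
      using inj by (auto simp: inj_on_def)
  qed
  then obtain k where k: "\<And>z w. (z, w) \<in> torus \<Longrightarrow> Re (trig_eval k z w) \<ge> 0" "Re (trig_eval k 1 1) = 1"
    and k3: "Re (trig_pair \<psi> k) \<le> cmod (\<psi> (0, 0)) / real 1000 + 1 / 1000"
    by (rule concentrated_kernel[where N = 1000 and \<epsilon> = "1 / 1000"]) auto
  have twist: "2 * Re (trig_pair \<psi> p) \<le> 3 * Re (trig_pair (\<lambda>u. \<phi> (t (S u))) p) + 12 * (4 * \<tau>)"
    if p: "\<And>z w. (z, w) \<in> torus \<Longrightarrow> Re (trig_eval p z w) \<in> {0..2}"
      and g: "g \<in> D" "inv g \<in> D" and S: "\<And>u. g \<otimes> t (S u) = t u \<otimes> g" for p g S
  proof -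
    have gG: "g \<in> carrier G" using g \<open>D \<subseteq> carrier G\<close> by blast
    have "inv g \<otimes> t u \<otimes> g = t (S u)" for u
      using S[of u, symmetric] gG t(1) by (simp add: m_assoc) (simp add: m_assoc[symmetric])
    moreover have "Re (2 * \<phi> \<one> - \<phi> g - \<phi> (inv g)) \<le> 4 * \<tau>"
      using near1(1)[of \<one>] near1(1)[OF g(1)] near1(1)[OF g(2)] by (simp add: D_def)
    ultimately show ?thesis
      using trig_pair_conjugate_le[OF G \<phi> t gG p] by (simp add: \<psi>_def[abs_def])
  qed
  have inv_shear: "inv g \<otimes> t u = t v \<otimes> inv g" if "g \<in> carrier G" "g \<otimes> t v = t u \<otimes> g" for g u v
  proof -
    have "inv g \<otimes> t u = inv g \<otimes> (t u \<otimes> g) \<otimes> inv g"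
      using that(1) t(1) by (simp add: m_assoc)
    also have "\<dots> = t v \<otimes> inv g"
      using that(1) t(1) by (simp add: that(2)[symmetric] m_assoc[symmetric])
    finally show ?thesis .
  qed
  have "Re (\<psi> (0, 0)) / 2 \<le>
    96 * real m ^ 4 * Re (4 * \<psi> (0, 0) - 2 * \<psi> (1, 0) - 2 * \<psi> (0, 1)) + 28 * Re (trig_pair \<psi> k) + 48 * (4 * \<tau>)"
  proof (rule shear_invariance_bound[OF \<psi> m _ _ k])
    fix p i assume p: "\<And>z w. (z, w) \<in> torus \<Longrightarrow> Re (trig_eval p z w) \<in> {0..2}" and i: "\<bar>i\<bar> = int m"
    from i consider "i = int m" | "i = - int m" by linarith
    then show "2 * Re (trig_pair \<psi> p) \<le> 3 * Re (trig_pair \<psi> (shear_snd i p)) + 12 * (4 * \<tau>)"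
    proof cases
      case 1
      have "inv a \<otimes> t (x + int m * y, y) = t (x, y) \<otimes> inv a" for x y
        by (rule inv_shear) (use a in auto)
      from twist[OF p, of "inv a" "\<lambda>(x, y). (x + int m * y, y)"] this 1 a(1) show ?thesis
        by (simp add: D_def case_prod_unfold trig_pair_shear_snd \<psi>_def[abs_def])
    next
      case 2
      from twist[OF p, of a "\<lambda>(x, y). (x - int m * y, y)"] a 2 show ?thesis
        by (simp add: D_def case_prod_unfold trig_pair_shear_snd \<psi>_def[abs_def])
    qed
    from i consider "i = int m" | "i = - int m" by linarith
    then show "2 * Re (trig_pair \<psi> p) \<le> 3 * Re (trig_pair \<psi> (shear_fst i p)) + 12 * (4 * \<tau>)"
    proof cases
      case 1
      have "inv b \<otimes> t (x, y + int m * x) = t (x, y) \<otimes> inv b" for x y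
        by (rule inv_shear) (use b in auto)
      from twist[OF p, of "inv b" "\<lambda>(x, y). (x, y + int m * x)"] this 1 b(1) show ?thesis
        by (simp add: D_def case_prod_unfold trig_pair_shear_fst \<psi>_def[abs_def])
    next
      case 2
      from twist[OF p, of b "\<lambda>(x, y). (x, y - int m * x)"] b 2 show ?thesis
        by (simp add: D_def case_prod_unfold trig_pair_shear_fst \<psi>_def[abs_def])
    qed
  qed
  moreover have "real m ^ 4 * Re (4 * \<psi> (0, 0) - 2 * \<psi> (1, 0) - 2 * \<psi> (0, 1)) \<le> real m ^ 4 * (8 * \<tau>)"
    using near1(1)[of \<one>] near1(1)[of "t (1, 0)"] near1(1)[of "t (0, 1)"]
    by (intro mult_left_mono) (auto simp: D_def \<psi>_def t0)
  moreover have "Re (\<psi> (0, 0)) \<ge> 1 - \<tau>" "cmod (\<psi> (0, 0)) \<le> 1 + \<tau>"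
    using near1[of \<one>] by (auto simp: D_def \<psi>_def t0)
  ultimately show False
    using k3 \<tau> m\<tau> by simp
qed

section \<open>Transvections in subgroups containing \<open>HZ\<close>\<close>

lemmas matrix3_simps = vec_eq_iff forall_3 matrix_matrix_mult_def matrix_vector_mult_def
  vector_matrix_mult_def sum_3 mat_def

definition adjugate3 :: "int ^ 3 ^ 3 \<Rightarrow> int ^ 3 ^ 3" where
  "adjugate3 A = vector
    [vector [A$2$2 * A$3$3 - A$2$3 * A$3$2, A$1$3 * A$3$2 - A$1$2 * A$3$3, A$1$2 * A$2$3 - A$1$3 * A$2$2],
     vector [A$2$3 * A$3$1 - A$2$1 * A$3$3, A$1$1 * A$3$3 - A$1$3 * A$3$1, A$1$3 * A$2$1 - A$1$1 * A$2$3],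
     vector [A$2$1 * A$3$2 - A$2$2 * A$3$1, A$1$2 * A$3$1 - A$1$1 * A$3$2, A$1$1 * A$2$2 - A$1$2 * A$2$1]]"

lemma adjugate3_mult:
  assumes "det A = 1"
  shows "adjugate3 A ** A = mat 1" "A ** adjugate3 A = mat 1"
  using assms by (simp_all add: matrix3_simps adjugate3_def det_3 algebra_simps)

lemma det_adjugate3:
  assumes "det A = 1"
  shows "det (adjugate3 A) = 1"
  using det_mul[of A "adjugate3 A"] adjugate3_mult(2)[OF assms] assms by simp

lemma SL3Z_simps [simp]:
  "carrier SL3Z = {A. det A = 1}" "mult SL3Z = (**)" "one SL3Z = mat 1"
  by (simp_all add: SL3Z_def)

lemma group_SL3Z: "group SL3Z"
proof (rule groupI)
  fix A assume "A \<in> carrier SL3Z"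
  then show "\<exists>B\<in>carrier SL3Z. B \<otimes>\<^bsub>SL3Z\<^esub> A = \<one>\<^bsub>SL3Z\<^esub>"
    using adjugate3_mult det_adjugate3 by (intro bexI[of _ "adjugate3 A"]) auto
qed (auto simp: det_mul matrix_mul_assoc)

lemma inv_SL3Z:
  assumes "det A = 1"
  shows "inv\<^bsub>SL3Z\<^esub> A = adjugate3 A"
  using assms by (intro group.inv_equality[OF group_SL3Z]) (auto simp: adjugate3_mult det_adjugate3)

lemma subgroup_HZ: "subgroup HZ SL3Z"
proof (rule group.subgroupI[OF group_SL3Z])
  show "HZ \<subseteq> carrier SL3Z" by (auto simp: HZ_def)
  have "mat 1 \<in> HZ" by (simp add: HZ_def) (simp add: mat_def)
  then show "HZ \<noteq> {}" by blast
  show "inv\<^bsub>SL3Z\<^esub> A \<in> HZ" if "A \<in> HZ" for A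
    using that by (auto simp: HZ_def inv_SL3Z det_adjugate3) (auto simp: adjugate3_def)
  show "A \<otimes>\<^bsub>SL3Z\<^esub> B \<in> HZ" if "A \<in> HZ" "B \<in> HZ" for A B
    using that by (auto simp: HZ_def det_mul) (auto simp: matrix3_simps)
qed

definition transvection :: "int ^ 3 \<Rightarrow> int ^ 3 \<Rightarrow> int ^ 3 ^ 3" where
  "transvection v l = (\<chi> i j. (if i = j then 1 else 0) + v $ i * l $ j)"

lemma transvection_in_HZ:
  assumes "v $ 1 * l $ 1 + v $ 2 * l $ 2 + v $ 3 * l $ 3 = 0"
    and "v $ 2 * l $ 1 = 0" "v $ 3 * l $ 1 = 0" "v $ 3 * l $ 2 = 0"
  shows "transvection v l \<in> HZ"
proof -
  have "det (transvection v l) = 1 + (v $ 1 * l $ 1 + v $ 2 * l $ 2 + v $ 3 * l $ 3)"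
    by (simp add: transvection_def det_3 algebra_simps)
  then show ?thesis
    using assms by (simp add: HZ_def transvection_def)
qed

lemma transvection_intertwine:
  "g ** transvection v (l v* g) = transvection (g *v v) l ** g"
  by (simp add: transvection_def matrix3_simps algebra_simps)

lemma transvection_conjugate:
  assumes K: "subgroup K SL3Z" and g: "g \<in> K"
  shows "transvection v (l v* g) \<in> K \<longleftrightarrow> transvection (g *v v) l \<in> K"
proof -
  interpret group SL3Z by (rule group_SL3Z)
  have K': "inv\<^bsub>SL3Z\<^esub> g \<in> K" "det g = 1"
    using subgroup.m_inv_closed[OF K g] subgroup.mem_carrier[OF K g] by auto
  have inv: "inv\<^bsub>SL3Z\<^esub> g ** g = mat 1" "g ** inv\<^bsub>SL3Z\<^esub> g = mat 1"
    using K'(2) by (simp_all add: inv_SL3Z adjugate3_mult)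
  have "transvection (g *v v) l = g ** transvection v (l v* g) ** inv\<^bsub>SL3Z\<^esub> g"
    unfolding transvection_intertwine using inv by (simp flip: matrix_mul_assoc)
  moreover have "transvection v (l v* g) = inv\<^bsub>SL3Z\<^esub> g ** (transvection (g *v v) l ** g)"
    unfolding transvection_intertwine[symmetric] using inv by (simp add: matrix_mul_assoc)
  ultimately show ?thesis
    using subgroup.m_closed[OF K] K' g by (metis SL3Z_simps(2))
qed

text \<open>With \<open>w = g e\<^sub>1\<close> and a covector \<open>\<nu>\<close> killing \<open>e\<^sub>1\<close> and \<open>w\<close>, the copy of \<open>\<int>\<^sup>2\<close> is
  \<open>1 + (x e\<^sub>1 + y w) \<otimes> \<nu>\<close>, sheared by transvections along \<open>e\<^sub>1\<close> and \<open>w\<close>.  The next lemma is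
  the dual construction, with vectors and covectors exchanged.\<close>

lemma not_haagerup_first_column:
  assumes K: "subgroup K SL3Z" and HK: "HZ \<subseteq> K" and g: "g \<in> K"
    and ne: "g $ 2 $ 1 \<noteq> 0 \<or> g $ 3 $ 1 \<noteq> 0"
  shows "\<not> haagerup_property (SL3Z\<lparr>carrier := K\<rparr>)"
proof
  assume H: "haagerup_property (SL3Z\<lparr>carrier := K\<rparr>)"
  define p q r where "p = g $ 1 $ 1" and "q = g $ 2 $ 1" and "r = g $ 3 $ 1"
  define m where "m = 5 * (q * q + r * r)"
  have "q * q + r * r > 0"
    using ne by (simp add: q_def r_def sum_squares_gt_zero_iff)
  then have m: "m \<ge> 5" by (simp add: m_def)
  define e :: "int ^ 3" where "e = vector [1, 0, 0]"
  define w :: "int ^ 3" where "w = vector [p, q, r]"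
  have w: "g *v e = w"
    by (simp add: e_def w_def p_def q_def r_def matrix3_simps)
  have e_K: "transvection e l \<in> K" if "l $ 1 = 0" for l
    using that HK transvection_in_HZ[of e l] by (auto simp: e_def)
  have w_K: "transvection w l \<in> K" if "l $ 1 * p + l $ 2 * q + l $ 3 * r = 0" for l
  proof -
    have "(l v* g) $ 1 = 0"
      using that by (simp add: matrix3_simps p_def q_def r_def algebra_simps)
    then have "transvection e (l v* g) \<in> K" by (rule e_K)
    then show ?thesis
      unfolding transvection_conjugate[OF K g] w .
  qed
  define t :: "int \<times> int \<Rightarrow> int ^ 3 ^ 3" where
    "t = (\<lambda>(x, y). transvection (vector [x + y * p, y * q, y * r]) (vector [0, r, - q]))"
  define a where "a = transvection e (vector [0, 5 * q, 5 * r])"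
  define b where "b = transvection w (vector [m, - (5 * p * q), - (5 * p * r)])"
  show False
  proof (rule not_haagerup_if_shears[OF H, of t a "nat m" b])
    fix u v :: "int \<times> int"
    obtain x y where u: "u = (x, y)" by fastforce
    have "t u = transvection e (vector [0, x * r, - (x * q)]) ** transvection w (vector [0, y * r, - (y * q)])"
      by (simp add: u t_def transvection_def matrix3_simps e_def w_def algebra_simps)
    then have "t u \<in> K"
      using e_K[of "vector [0, x * r, - (x * q)]"] w_K[of "vector [0, y * r, - (y * q)]"]
        subgroup.m_closed[OF K] by simp
    then show "t u \<in> carrier (SL3Z\<lparr>carrier := K\<rparr>)" by simp
    show "t (u + v) = t u \<otimes>\<^bsub>SL3Z\<lparr>carrier := K\<rparr>\<^esub> t v"
      by (cases v) (simp add: u t_def transvection_def matrix3_simps algebra_simps)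
  next
    show "inj t"
      using ne by (auto simp: inj_def t_def transvection_def vec_eq_iff forall_3 q_def[symmetric] r_def[symmetric])
    show "a \<in> carrier (SL3Z\<lparr>carrier := K\<rparr>)"
      using e_K by (simp add: a_def)
    show "b \<in> carrier (SL3Z\<lparr>carrier := K\<rparr>)"
      using w_K[of "vector [m, - (5 * p * q), - (5 * p * r)]"] by (simp add: b_def m_def algebra_simps)
    fix x y
    show "a \<otimes>\<^bsub>SL3Z\<lparr>carrier := K\<rparr>\<^esub> t (x, y) = t (x + int (nat m) * y, y) \<otimes>\<^bsub>SL3Z\<lparr>carrier := K\<rparr>\<^esub> a"
      using m by (simp add: a_def t_def e_def transvection_def matrix3_simps) (simp add: m_def algebra_simps)
    show "b \<otimes>\<^bsub>SL3Z\<lparr>carrier := K\<rparr>\<^esub> t (x, y) = t (x, y + int (nat m) * x) \<otimes>\<^bsub>SL3Z\<lparr>carrier := K\<rparr>\<^esub> b"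
      using m by (simp add: b_def t_def w_def transvection_def matrix3_simps) (simp add: m_def algebra_simps)
  qed (use m in simp)
qed

lemma not_haagerup_last_row:
  assumes K: "subgroup K SL3Z" and HK: "HZ \<subseteq> K" and g: "g \<in> K"
    and g31: "g $ 3 $ 1 = 0" and ne: "g $ 3 $ 2 \<noteq> 0"
  shows "\<not> haagerup_property (SL3Z\<lparr>carrier := K\<rparr>)"
proof
  assume H: "haagerup_property (SL3Z\<lparr>carrier := K\<rparr>)"
  define r s where "r = g $ 3 $ 2" and "s = g $ 3 $ 3"
  define m where "m = 5 * (r * r)"
  have "r * r > 0" using ne by (auto simp: r_def zero_less_mult_iff)
  then have m: "m \<ge> 5" by (simp add: m_def)
  define e :: "int ^ 3" where "e = vector [0, 0, 1]"
  define w :: "int ^ 3" where "w = vector [0, r, s]"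
  have w: "e v* g = w"
    using g31 by (simp add: e_def w_def r_def s_def matrix3_simps)
  have e_K: "transvection v e \<in> K" if "v $ 3 = 0" for v
    using that HK transvection_in_HZ[of v e] by (auto simp: e_def)
  have w_K: "transvection v w \<in> K" if "v $ 2 * r + v $ 3 * s = 0" for v
  proof -
    have "(g *v v) $ 3 = 0"
      using that g31 by (simp add: matrix3_simps r_def s_def algebra_simps)
    then have "transvection (g *v v) e \<in> K" by (rule e_K)
    then show ?thesis
      unfolding transvection_conjugate[OF K g, symmetric] w .
  qed
  define t :: "int \<times> int \<Rightarrow> int ^ 3 ^ 3" where
    "t = (\<lambda>(x, y). transvection (vector [1, 0, 0]) (vector [0, y * r, x + y * s]))"
  define a where "a = transvection (vector [0, - (5 * r), 0]) e"
  define b where "b = transvection (vector [0, 5 * r * s, - m]) w"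
  show False
  proof (rule not_haagerup_if_shears[OF H, of t a "nat m" b])
    fix u v :: "int \<times> int"
    obtain x y where u: "u = (x, y)" by fastforce
    show "t u \<in> carrier (SL3Z\<lparr>carrier := K\<rparr>)"
      using HK transvection_in_HZ by (force simp: u t_def)
    show "t (u + v) = t u \<otimes>\<^bsub>SL3Z\<lparr>carrier := K\<rparr>\<^esub> t v"
      by (cases v) (simp add: u t_def transvection_def matrix3_simps algebra_simps)
  next
    show "inj t"
      using ne by (auto simp: inj_def t_def transvection_def vec_eq_iff forall_3 r_def[symmetric])
    show "a \<in> carrier (SL3Z\<lparr>carrier := K\<rparr>)"
      using e_K by (simp add: a_def)
    show "b \<in> carrier (SL3Z\<lparr>carrier := K\<rparr>)"
      using w_K[of "vector [0, 5 * r * s, - m]"] by (simp add: b_def m_def algebra_simps)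
    fix x y
    show "a \<otimes>\<^bsub>SL3Z\<lparr>carrier := K\<rparr>\<^esub> t (x, y) = t (x + int (nat m) * y, y) \<otimes>\<^bsub>SL3Z\<lparr>carrier := K\<rparr>\<^esub> a"
      using m by (simp add: a_def t_def e_def transvection_def matrix3_simps) (simp add: m_def algebra_simps)
    show "b \<otimes>\<^bsub>SL3Z\<lparr>carrier := K\<rparr>\<^esub> t (x, y) = t (x, y + int (nat m) * x) \<otimes>\<^bsub>SL3Z\<lparr>carrier := K\<rparr>\<^esub> b"
      using m by (simp add: b_def t_def w_def transvection_def matrix3_simps) (simp add: m_def algebra_simps)
  qed (use m in simp)
qed

section \<open>Folner sets\<close>

lemma haagerup_property_if_Folner:
  fixes G :: "('a, 'b) monoid_scheme" (structure) and F :: "nat \<Rightarrow> 'a set"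
  assumes "group G" and F: "\<And>n. finite (F n)" "\<And>n. F n \<subseteq> carrier G"
    and lim: "\<And>g. g \<in> carrier G \<Longrightarrow>
      (\<lambda>n. real (card {x \<in> F n. g \<otimes> x \<in> F n}) / real (card (F n))) \<longlonglongrightarrow> 1"
  shows "haagerup_property G"
proof -
  interpret group G by fact
  define \<phi> where "\<phi> n g = complex_of_real (real (card {x \<in> F n. g \<otimes> x \<in> F n}) / real (card (F n)))" for n g
  have "positive_definite G (\<phi> n)" for n
    unfolding positive_definite_def
  proof (intro allI impI)
    fix S :: "'a set" and c :: "'a \<Rightarrow> complex"
    assume S: "finite S" "S \<subseteq> carrier G"
    define Y where "Y = (\<lambda>(h, x). h \<otimes> x) ` (S \<times> F n)"
    have Y: "finite Y" "Y \<subseteq> carrier G" using S F[of n] by (auto simp: Y_def)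
    define d where "d g y = (if inv g \<otimes> y \<in> F n then 1 else 0 :: complex)" for g y
    have card: "of_nat (card {x \<in> F n. inv g \<otimes> h \<otimes> x \<in> F n}) = (\<Sum>y\<in>Y. d g y * d h y)"
      if gh: "g \<in> S" "h \<in> S" for g h
    proof -
      have "bij_betw (\<lambda>x. h \<otimes> x) {x \<in> F n. inv g \<otimes> h \<otimes> x \<in> F n} {y \<in> Y. inv g \<otimes> y \<in> F n \<and> inv h \<otimes> y \<in> F n}"
      proof (rule bij_betw_byWitness[where f' = "\<lambda>y. inv h \<otimes> y"])
        have carr: "g \<in> carrier G" "h \<in> carrier G" "\<And>x. x \<in> F n \<Longrightarrow> x \<in> carrier G" "\<And>y. y \<in> Y \<Longrightarrow> y \<in> carrier G"
          using S F(2)[of n] Y(2) gh by auto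
        show "\<forall>x\<in>{x \<in> F n. inv g \<otimes> h \<otimes> x \<in> F n}. inv h \<otimes> (h \<otimes> x) = x"
          using carr by (simp add: m_assoc[symmetric])
        show "\<forall>y\<in>{y \<in> Y. inv g \<otimes> y \<in> F n \<and> inv h \<otimes> y \<in> F n}. h \<otimes> (inv h \<otimes> y) = y"
          using carr by (simp add: m_assoc[symmetric])
        show "(\<lambda>x. h \<otimes> x) ` {x \<in> F n. inv g \<otimes> h \<otimes> x \<in> F n} \<subseteq> {y \<in> Y. inv g \<otimes> y \<in> F n \<and> inv h \<otimes> y \<in> F n}"
        proof
          fix y assume "y \<in> (\<lambda>x. h \<otimes> x) ` {x \<in> F n. inv g \<otimes> h \<otimes> x \<in> F n}"
          then obtain x where x: "x \<in> F n" "inv g \<otimes> h \<otimes> x \<in> F n" "y = h \<otimes> x" by blast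
          have "y \<in> Y" using gh x by (auto simp: Y_def)
          moreover have "inv g \<otimes> y = inv g \<otimes> h \<otimes> x" "inv h \<otimes> y = x"
            using carr x by (simp_all add: m_assoc) (simp add: m_assoc[symmetric])
          ultimately show "y \<in> {y \<in> Y. inv g \<otimes> y \<in> F n \<and> inv h \<otimes> y \<in> F n}"
            using x by simp
        qed
        show "(\<lambda>y. inv h \<otimes> y) ` {y \<in> Y. inv g \<otimes> y \<in> F n \<and> inv h \<otimes> y \<in> F n} \<subseteq> {x \<in> F n. inv g \<otimes> h \<otimes> x \<in> F n}"
        proof
          fix x assume "x \<in> (\<lambda>y. inv h \<otimes> y) ` {y \<in> Y. inv g \<otimes> y \<in> F n \<and> inv h \<otimes> y \<in> F n}"
          then obtain y where y: "y \<in> Y" "inv g \<otimes> y \<in> F n" "inv h \<otimes> y \<in> F n" "x = inv h \<otimes> y" by blast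
          have "h \<otimes> (inv h \<otimes> y) = y"
            using carr y by (simp add: m_assoc[symmetric])
          then have "inv g \<otimes> h \<otimes> x = inv g \<otimes> y"
            using carr y by (simp add: m_assoc)
          then show "x \<in> {x \<in> F n. inv g \<otimes> h \<otimes> x \<in> F n}"
            using y by simp
        qed
      qed
      then have "card {x \<in> F n. inv g \<otimes> h \<otimes> x \<in> F n} = card {y \<in> Y. inv g \<otimes> y \<in> F n \<and> inv h \<otimes> y \<in> F n}"
        by (rule bij_betw_same_card)
      also have "of_nat \<dots> = (\<Sum>y\<in>Y. if inv g \<otimes> y \<in> F n \<and> inv h \<otimes> y \<in> F n then 1 else 0 :: complex)"
        using Y(1) by (simp flip: sum.inter_filter)
      also have "\<dots> = (\<Sum>y\<in>Y. d g y * d h y)"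
        by (intro sum.cong) (auto simp: d_def)
      finally show ?thesis .
    qed
    have "(\<Sum>g\<in>S. \<Sum>h\<in>S. cnj (c g) * c h * \<phi> n (inv g \<otimes> h)) =
        (\<Sum>g\<in>S. \<Sum>h\<in>S. \<Sum>y\<in>Y. cnj (c g * d g y) * (c h * d h y) / of_nat (card (F n)))"
    proof (intro sum.cong refl)
      fix g h assume "g \<in> S" "h \<in> S"
      moreover have "cnj (d g y) = d g y" for y by (simp add: d_def)
      ultimately show "cnj (c g) * c h * \<phi> n (inv g \<otimes> h) =
          (\<Sum>y\<in>Y. cnj (c g * d g y) * (c h * d h y) / of_nat (card (F n)))"
        by (simp add: \<phi>_def card sum_distrib_left sum_divide_distrib mult_ac)
    qed
    also have "\<dots> = (\<Sum>y\<in>Y. \<Sum>g\<in>S. \<Sum>h\<in>S. cnj (c g * d g y) * (c h * d h y) / of_nat (card (F n)))"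
      by (simp only: sum.swap[of _ Y S])
    also have "\<dots> = (\<Sum>y\<in>Y. cnj (\<Sum>g\<in>S. c g * d g y) * (\<Sum>h\<in>S. c h * d h y) / of_nat (card (F n)))"
      by (simp only: cnj_sum sum_product sum_divide_distrib)
    also have "\<dots> = of_real (\<Sum>y\<in>Y. (cmod (\<Sum>g\<in>S. c g * d g y))\<^sup>2 / real (card (F n)))"
    proof -
      have "cnj z * z = of_real ((cmod z)\<^sup>2)" for z
        by (simp only: complex_norm_square mult.commute)
      then show ?thesis
        by (simp only: of_real_sum of_real_divide of_real_of_nat_eq)
    qed
    also have "\<dots> \<in> \<real>\<^sub>\<ge>\<^sub>0"
      by (simp only: nonneg_Reals_of_real_iff) (intro sum_nonneg divide_nonneg_nonneg; simp)
    finally show "(\<Sum>g\<in>S. \<Sum>h\<in>S. cnj (c g) * c h * \<phi> n (inv g \<otimes> h)) \<in> \<real>\<^sub>\<ge>\<^sub>0" .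
  qed
  moreover have "vanishing_at_infinity G (\<phi> n)" for n
    unfolding vanishing_at_infinity_def
  proof (intro allI impI)
    fix \<epsilon> :: real assume "\<epsilon> > 0"
    have "{g \<in> carrier G. cmod (\<phi> n g) \<ge> \<epsilon>} \<subseteq> (\<lambda>(x, y). y \<otimes> inv x) ` (F n \<times> F n)"
    proof
      fix g assume g: "g \<in> {g \<in> carrier G. cmod (\<phi> n g) \<ge> \<epsilon>}"
      have "{x \<in> F n. g \<otimes> x \<in> F n} \<noteq> {}"
      proof
        assume "{x \<in> F n. g \<otimes> x \<in> F n} = {}"
        then have "\<phi> n g = 0" by (simp only: \<phi>_def) simp
        with g \<open>\<epsilon> > 0\<close> show False by simp
      qed
      then obtain x where x: "x \<in> F n" "g \<otimes> x \<in> F n" by blast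
      moreover have "g = g \<otimes> x \<otimes> inv x"
        using g x F(2)[of n] by (auto simp: m_assoc)
      ultimately show "g \<in> (\<lambda>(x, y). y \<otimes> inv x) ` (F n \<times> F n)" by force
    qed
    then show "finite {g \<in> carrier G. cmod (\<phi> n g) \<ge> \<epsilon>}"
      by (rule finite_subset) (simp add: F)
  qed
  moreover have "(\<lambda>n. \<phi> n g) \<longlonglongrightarrow> 1" if "g \<in> carrier G" for g
  proof -
    have "(\<lambda>n. \<phi> n g) \<longlonglongrightarrow> complex_of_real 1"
      unfolding \<phi>_def by (rule tendsto_of_real[OF lim[OF that]])
    then show ?thesis by simp
  qed
  ultimately show ?thesis
    unfolding haagerup_property_def using \<open>group G\<close> by blast
qed

lemma abs_eq_1_if_triple_product:
  fixes x y z :: int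
  assumes "x * y * z = 1"
  shows "\<bar>x\<bar> = 1" "\<bar>y\<bar> = 1" "\<bar>z\<bar> = 1"
  using assms abs_zmult_eq_1[of x "y * z"] abs_zmult_eq_1[of y "x * z"] abs_zmult_eq_1[of z "x * y"]
  by (simp_all add: mult_ac)

lemma HZ_iff:
  "A \<in> HZ \<longleftrightarrow> A $ 1 $ 1 * A $ 2 $ 2 * A $ 3 $ 3 = 1 \<and> A $ 2 $ 1 = 0 \<and> A $ 3 $ 1 = 0 \<and> A $ 3 $ 2 = 0"
  by (auto simp: HZ_def det_3)

lemma HZ_diagonal:
  assumes "A \<in> HZ"
  shows "\<bar>A $ 1 $ 1\<bar> = 1" "\<bar>A $ 2 $ 2\<bar> = 1" "\<bar>A $ 3 $ 3\<bar> = 1"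
  using assms abs_eq_1_if_triple_product by (auto simp: HZ_iff)

definition HZ_box :: "nat \<Rightarrow> nat \<Rightarrow> (int ^ 3 ^ 3) set" where
  "HZ_box p r = {A \<in> HZ. \<bar>A $ 1 $ 2\<bar> \<le> int p \<and> \<bar>A $ 2 $ 3\<bar> \<le> int p \<and> \<bar>A $ 1 $ 3\<bar> \<le> int r}"

definition sign_triples :: "(int \<times> int \<times> int) set" where
  "sign_triples = {(x, y, z). x * y * z = 1}"

lemma finite_sign_triples: "finite sign_triples"
proof (rule finite_subset)
  show "sign_triples \<subseteq> {x. \<bar>x\<bar> = 1} \<times> {y. \<bar>y\<bar> = 1} \<times> {z. \<bar>z\<bar> = 1}"
    using abs_eq_1_if_triple_product by (auto simp: sign_triples_def)
  have "{x :: int. \<bar>x\<bar> = 1} = {-1, 1}" by auto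
  then show "finite ({x :: int. \<bar>x\<bar> = 1} \<times> {y :: int. \<bar>y\<bar> = 1} \<times> {z :: int. \<bar>z\<bar> = 1})" by simp
qed

lemma card_sign_triples: "card sign_triples > 0"
proof -
  have "(1, 1, 1) \<in> sign_triples" by (simp add: sign_triples_def)
  then show ?thesis using finite_sign_triples by (auto simp: card_gt_0_iff)
qed

lemma HZ_box_card:
  "finite (HZ_box p r)" "card (HZ_box p r) = card sign_triples * ((2 * p + 1) ^ 2 * (2 * r + 1))"
proof -
  let ?B = "sign_triples \<times> {- int p..int p} \<times> {- int p..int p} \<times> {- int r..int r}"
  let ?f = "\<lambda>A :: int ^ 3 ^ 3. ((A $ 1 $ 1, A $ 2 $ 2, A $ 3 $ 3), A $ 1 $ 2, A $ 2 $ 3, A $ 1 $ 3)"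
  let ?g = "\<lambda>((x, y, z), a, b, c). vector [vector [x, a, c], vector [0, y, b], vector [0, 0, z]] :: int ^ 3 ^ 3"
  have bij: "bij_betw ?f (HZ_box p r) ?B"
    by (rule bij_betw_byWitness[where f' = ?g])
       (auto simp: HZ_box_def HZ_iff sign_triples_def vec_eq_iff forall_3)
  have "finite ?B" using finite_sign_triples by simp
  then show "finite (HZ_box p r)" using bij_betw_finite[OF bij] by simp
  have "card (HZ_box p r) = card ?B" by (rule bij_betw_same_card[OF bij])
  moreover have "nat (2 * int k + 1) = 2 * k + 1" for k by simp
  ultimately show "card (HZ_box p r) = card sign_triples * ((2 * p + 1) ^ 2 * (2 * r + 1))"
    by (simp add: card_cartesian_product power2_eq_square algebra_simps)
qed

lemma haagerup_HZ: "haagerup_property (SL3Z\<lparr>carrier := HZ\<rparr>)"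
proof (rule haagerup_property_if_Folner)
  show "group (SL3Z\<lparr>carrier := HZ\<rparr>)"
    by (rule subgroup.subgroup_is_group[OF subgroup_HZ group_SL3Z])
  show "finite (HZ_box n (n ^ 2))" for n by (rule HZ_box_card)
  show "HZ_box n (n ^ 2) \<subseteq> carrier (SL3Z\<lparr>carrier := HZ\<rparr>)" for n
    by (auto simp: HZ_box_def)
  fix g assume "g \<in> carrier (SL3Z\<lparr>carrier := HZ\<rparr>)"
  then have g: "g \<in> HZ" by simp
  define D where "D = nat (\<bar>g $ 1 $ 2\<bar> + \<bar>g $ 2 $ 3\<bar> + \<bar>g $ 1 $ 3\<bar>)"
  have D: "\<bar>g $ 1 $ 2\<bar> \<le> int D" "\<bar>g $ 2 $ 3\<bar> \<le> int D" "\<bar>g $ 1 $ 3\<bar> \<le> int D"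
    by (auto simp: D_def)
  let ?r = "\<lambda>n. real (card {x \<in> HZ_box n (n ^ 2). g \<otimes>\<^bsub>SL3Z\<lparr>carrier := HZ\<rparr>\<^esub> x \<in> HZ_box n (n ^ 2)}) / real (card (HZ_box n (n ^ 2)))"
  let ?l = "\<lambda>n. (2 * (real n - real D) + 1) ^ 2 * (2 * (real n ^ 2 - real D * real n - real D) + 1) / ((2 * real n + 1) ^ 2 * (2 * real n ^ 2 + 1))"
  show "?r \<longlonglongrightarrow> 1"
  proof (rule tendsto_sandwich[of ?l ?r sequentially "\<lambda>_. 1"])
    show "?l \<longlonglongrightarrow> 1" by real_asymp
    show "\<forall>\<^sub>F n in sequentially. ?r n \<le> 1"
      by (intro always_eventually allI divide_le_eq_1[THEN iffD2])
         (auto intro!: card_mono HZ_box_card(1))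
    show "\<forall>\<^sub>F n in sequentially. ?l n \<le> ?r n"
      using eventually_ge_at_top[of "2 * D + 2"]
    proof eventually_elim
      fix n :: nat assume n: "n \<ge> 2 * D + 2"
      have "D * n + D \<le> n ^ 2"
      proof -
        have "D * n + D \<le> (2 * D + 2) * n" using n by (simp add: algebra_simps)
        also have "\<dots> \<le> n * n" using n by (intro mult_right_mono) auto
        finally show ?thesis by (simp add: power2_eq_square)
      qed
      then have r: "real (n ^ 2 - (D * n + D)) = real n ^ 2 - real D * real n - real D"
        "int (n ^ 2 - (D * n + D)) = int n ^ 2 - int D * int n - int D"
        by (simp_all add: of_nat_diff)
      have "HZ_box (n - D) (n ^ 2 - (D * n + D)) \<subseteq> {x \<in> HZ_box n (n ^ 2). g ** x \<in> HZ_box n (n ^ 2)}"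
      proof
        fix x assume "x \<in> HZ_box (n - D) (n ^ 2 - (D * n + D))"
        then have x: "x \<in> HZ" "\<bar>x $ 1 $ 2\<bar> \<le> int n - int D" "\<bar>x $ 2 $ 3\<bar> \<le> int n - int D"
            "\<bar>x $ 1 $ 3\<bar> \<le> int n ^ 2 - int D * int n - int D"
          using n by (auto simp: HZ_box_def r)
        have "int D * int n \<ge> 0" by simp
        then have "\<bar>x $ 1 $ 3\<bar> \<le> int n ^ 2" using x(4) by linarith
        with x have "x \<in> HZ_box n (n ^ 2)"
          unfolding HZ_box_def by simp
        moreover have gx: "g ** x \<in> HZ"
          using subgroup.m_closed[OF subgroup_HZ g x(1)] by simp
        moreover have "\<bar>(g ** x) $ 1 $ 2\<bar> \<le> int n"
        proof -
          have "(g ** x) $ 1 $ 2 = g $ 1 $ 1 * x $ 1 $ 2 + g $ 1 $ 2 * x $ 2 $ 2"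
            using x(1) by (simp add: matrix3_simps HZ_iff)
          also have "\<bar>\<dots>\<bar> \<le> \<bar>g $ 1 $ 1 * x $ 1 $ 2\<bar> + \<bar>g $ 1 $ 2 * x $ 2 $ 2\<bar>"
            by (rule abs_triangle_ineq)
          also have "\<dots> = \<bar>x $ 1 $ 2\<bar> + \<bar>g $ 1 $ 2\<bar>"
            using HZ_diagonal[OF g] HZ_diagonal[OF x(1)] by (simp add: abs_mult)
          finally show ?thesis using x D by simp
        qed
        moreover have "\<bar>(g ** x) $ 2 $ 3\<bar> \<le> int n"
        proof -
          have "(g ** x) $ 2 $ 3 = g $ 2 $ 2 * x $ 2 $ 3 + g $ 2 $ 3 * x $ 3 $ 3"
            using g by (simp add: matrix3_simps HZ_iff)
          also have "\<bar>\<dots>\<bar> \<le> \<bar>g $ 2 $ 2 * x $ 2 $ 3\<bar> + \<bar>g $ 2 $ 3 * x $ 3 $ 3\<bar>"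
            by (rule abs_triangle_ineq)
          also have "\<dots> = \<bar>x $ 2 $ 3\<bar> + \<bar>g $ 2 $ 3\<bar>"
            using HZ_diagonal[OF g] HZ_diagonal[OF x(1)] by (simp add: abs_mult)
          finally show ?thesis using x D by simp
        qed
        moreover have "\<bar>(g ** x) $ 1 $ 3\<bar> \<le> int (n ^ 2)"
        proof -
          have "(g ** x) $ 1 $ 3 = g $ 1 $ 1 * x $ 1 $ 3 + g $ 1 $ 2 * x $ 2 $ 3 + g $ 1 $ 3 * x $ 3 $ 3"
            by (simp add: matrix3_simps)
          also have "\<bar>\<dots>\<bar> \<le> \<bar>g $ 1 $ 1 * x $ 1 $ 3\<bar> + \<bar>g $ 1 $ 2 * x $ 2 $ 3\<bar> + \<bar>g $ 1 $ 3 * x $ 3 $ 3\<bar>"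
            by linarith
          also have "\<dots> = \<bar>x $ 1 $ 3\<bar> + \<bar>g $ 1 $ 2\<bar> * \<bar>x $ 2 $ 3\<bar> + \<bar>g $ 1 $ 3\<bar>"
            using HZ_diagonal[OF g] HZ_diagonal[OF x(1)] by (simp add: abs_mult)
          also have "\<bar>g $ 1 $ 2\<bar> * \<bar>x $ 2 $ 3\<bar> \<le> int D * int n"
            using x D by (intro mult_mono) auto
          finally show ?thesis using x D by simp
        qed
        ultimately show "x \<in> {x \<in> HZ_box n (n ^ 2). g ** x \<in> HZ_box n (n ^ 2)}"
          by (simp add: HZ_box_def)
      qed
      then have "card (HZ_box (n - D) (n ^ 2 - (D * n + D))) \<le> card {x \<in> HZ_box n (n ^ 2). g ** x \<in> HZ_box n (n ^ 2)}"
        by (intro card_mono) (auto intro: finite_subset[OF _ HZ_box_card(1)])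
      then have "real (card (HZ_box (n - D) (n ^ 2 - (D * n + D)))) / real (card (HZ_box n (n ^ 2))) \<le> ?r n"
        by (simp add: divide_right_mono)
      moreover have "real (card (HZ_box (n - D) (n ^ 2 - (D * n + D)))) / real (card (HZ_box n (n ^ 2))) = ?l n"
      proof -
        have "real (card (HZ_box p q)) = real (card sign_triples) * ((2 * real p + 1) ^ 2 * (2 * real q + 1))" for p q
          by (simp only: HZ_box_card(2) of_nat_mult of_nat_add of_nat_power of_nat_1 of_nat_numeral)
        moreover have "real (n - D) = real n - real D"
          using n by (simp add: of_nat_diff)
        ultimately show ?thesis
          using card_sign_triples by (simp only: r(1) of_nat_power) simp
      qed
      ultimately show "?l n \<le> ?r n" by simp
    qed
  qed simp
qed

theorem proposition2p19: "maximal_haagerup_subgroup HZ SL3Z"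
  unfolding maximal_haagerup_subgroup_def haagerup_subgroup_def
proof (intro conjI allI impI subgroup_HZ haagerup_HZ notI)
  fix K assume K: "subgroup K SL3Z \<and> haagerup_property (SL3Z\<lparr>carrier := K\<rparr>)" and "HZ \<subset> K"
  then obtain g where g: "g \<in> K" "g \<notin> HZ" by blast
  with K have "g $ 2 $ 1 \<noteq> 0 \<or> g $ 3 $ 1 \<noteq> 0 \<or> g $ 3 $ 1 = 0 \<and> g $ 3 $ 2 \<noteq> 0"
    using subgroup.subset[of K SL3Z] by (auto simp: HZ_def)
  with K g(1) \<open>HZ \<subset> K\<close> show False
    using not_haagerup_first_column[of K g] not_haagerup_last_row[of K g] by blast
qed

end
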